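(* Let $n\ge1$ and let $I_n$ be the final index of the Bernoulli clock with $n$ pairs (defined in the context). Then for all $1\le k\le 2n$, $$\mathbb{P}(I_n=k)=\frac{1}{2n}-\delta_{k:2n},\qquad\text{where}\qquad \delta_{k:2n}=\frac{2^{n-1}}{n\;n!}\sum_{i=0}^{n}\frac{\binom{k-1}{i}\binom{n}{i}}{\binom{2n-1}{i}}\,B_{n-i}.$$
   Context: $B_j=B_j(0)$ are the Bernoulli numbers, with $\frac{\lambda}{e^\lambda-1}=\sum_{j\ge0}\frac{B_j}{j!}\lambda^j$ (so $B_1=-\frac12$). Bernoulli clock: let $U_1,U_1',\dots,U_n,U_n'$ be i.i.d. uniform on the circle $\mathbb{T}=\mathbb{R}/\mathbb{Z}=[0,1)$ of circumference $1$ (almost surely all distinct), with order statistics $U_{1:2n}<\dots<U_{2n:2n}$ in $[0,1)$. "Clockwise" means the direction of increasing coordinate, wrapping around from $1$ to $0$. Starting from $0$ move clockwise to the first of $U_1,U_1'$ encountered; then for $k=2,\dots,n$ in turn continue clockwise from the current position to whichever of $U_k,U_k'$ is encountered first. For $1\le k\le n$, $I_k\in\{1,\dots,2n\}$ is the random index such that the position reached at step $k$ is $U_{I_k:2n}$. *)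

theory Defs
  imports "HOL-Probability.Probability" "HOL-Computational_Algebra.Formal_Power_Series"
begin

(* Exponential generating function X / (e^X - 1); the divisor has zero constant term, so this is
   the quotient of formal power series (not multiplication by "inverse"), see bernoulli_num_gf. *)
definition bernoulli_num :: "nat \<Rightarrow> real" where
  "bernoulli_num j = fact j * fps_nth (fps_X / (fps_exp 1 - 1)) j"

lemma bernoulli_num_gf:
  "Abs_fps (\<lambda>j. bernoulli_num j / fact j) * (fps_exp 1 - 1) = fps_X"
proof -
  let ?E = "fps_exp 1 - 1 :: real fps"
  have E1: "fps_nth ?E 1 = 1" and E0: "fps_nth ?E 0 = 0" by simp_all
  have sub: "subdegree ?E = 1"
    by (rule subdegreeI) (use E1 E0 in auto)
  have "?E dvd fps_X"
    using sub by (metis fps_X_neq_zero E1 fps_dvd_iff fps_zero_nth order_refl subdegree_fps_X zero_neq_one)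
  moreover have "Abs_fps (\<lambda>j. bernoulli_num j / fact j) = fps_X / ?E"
    by (simp add: bernoulli_num_def fps_eq_iff)
  ultimately show ?thesis by simp
qed

(* Points of the circle are represented in [0,1); frac (y - x) is then the clockwise distance
   from x to y.  Entry i (1 <= i <= n) of u and v is the i-th pair.  Ties have probability 0. *)
primrec clock_pos :: "(nat \<Rightarrow> real) \<Rightarrow> (nat \<Rightarrow> real) \<Rightarrow> nat \<Rightarrow> real" where
  "clock_pos u v 0 = 0"
| "clock_pos u v (Suc k) =
     (if frac (u (Suc k) - clock_pos u v k) \<le> frac (v (Suc k) - clock_pos u v k)
      then u (Suc k) else v (Suc k))"

(* i-th smallest, 1 <= i <= 2n, of the 2n values u 1, ..., u n, v 1, ..., v n. *)
definition order_stat :: "nat \<Rightarrow> (nat \<Rightarrow> real) \<Rightarrow> (nat \<Rightarrow> real) \<Rightarrow> nat \<Rightarrow> real" where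
  "order_stat n u v i = sort (map u [1..<n+1] @ map v [1..<n+1]) ! (i - 1)"

(* The index I_k of the clock with n pairs.  It is the only such i when the 2n values are
   distinct; LEAST just fixes a value on the null event of ties. *)
definition clock_index :: "nat \<Rightarrow> (nat \<Rightarrow> real) \<Rightarrow> (nat \<Rightarrow> real) \<Rightarrow> nat \<Rightarrow> nat" where
  "clock_index n u v k = (LEAST i. i \<in> {1..2*n} \<and> clock_pos u v k = order_stat n u v i)"

definition clock_delta :: "nat \<Rightarrow> nat \<Rightarrow> real" where
  "clock_delta n k = 2 ^ (n - 1) / (real n * fact n) *
     (\<Sum>i=0..n. real ((k - 1) choose i) * real (n choose i) / real ((2 * n - 1) choose i)
        * bernoulli_num (n - i))"

end

theory Submission
  imports Defs "HOL-Combinatorics.Permutations" "HOL-Computational_Algebra.Polynomial"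
begin

text \<open>
  Write \<open>b\<^sub>m(x) = B\<^sub>m(x) / m!\<close> for the scaled Bernoulli polynomials.  The formula comes from computing
  the distribution function \<open>F\<^sub>n\<close> of the final position in two ways and comparing coefficients
  in the Bernstein basis of degree \<open>2n\<close>.

  First computation.  From position \<open>y\<close>, the first of two fresh uniform points lies in \<open>[0,x]\<close> with
  probability \<open>2xy - x\<^sup>2 + 2 max 0 (x - y)\<close> (\<open>prob_first_met_le\<close>), and
  \<open>E (x - X)\<^sup>+\<close> is the integral of the distribution function of \<open>X\<close> over \<open>[0,x]\<close>
  (\<open>expectation_pos_part\<close>).  Hence
  \<open>F\<^sub>k\<^sub>+\<^sub>1(x) = 2x (1 - G\<^sub>k(1)) - x\<^sup>2 + 2 G\<^sub>k(x)\<close> with \<open>G\<^sub>k(x)\<close> the integral of \<open>F\<^sub>k\<close> over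
  \<open>[0,x]\<close>.  As \<open>b\<^sub>m\<^sub>+\<^sub>1' = b\<^sub>m\<close>, and \<open>b\<^sub>m(1) = b\<^sub>m(0)\<close> for \<open>m \<noteq> 1\<close>, the solution is
  \<open>F\<^sub>k(x) = x - 2\<^sup>k (b\<^sub>k\<^sub>+\<^sub>1(x) - b\<^sub>k\<^sub>+\<^sub>1(0))\<close> for \<open>k \<ge> 1\<close> (\<open>prob_pos_le\<close>).

  Second computation.  The index \<open>I\<^sub>n\<close> depends only on the relative order of the \<open>2n\<close> points
  (\<open>clock_rank_cong_pattern\<close>), whereas the number \<open>N\<^sub>x\<close> of points in \<open>[0,x]\<close> is a symmetric function
  of them.  The relative order of exchangeable, almost surely distinct points is independent of
  every symmetric function (\<open>pattern_indep_symmetric\<close>), \<open>N\<^sub>x\<close> is binomial, and the final position is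
  at most \<open>x\<close> exactly when \<open>I\<^sub>n \<le> N\<^sub>x\<close> (\<open>clock_rank_le_iff\<close>).  So \<open>P(I\<^sub>n \<le> m)\<close>, for
  \<open>m \<le> 2n\<close>, are the Bernstein coefficients of \<open>F\<^sub>n\<close> in degree \<open>2n\<close>.  These are unique
  (\<open>bernstein_unique\<close>) and can be read off from the monomial coefficients (\<open>bernstein_power\<close>);
  taking the difference of two consecutive ones gives \<open>P(I\<^sub>n = k)\<close> (\<open>clock_coeff_diff\<close>).
\<close>

section \<open>Bernoulli polynomials and Bernstein coefficients\<close>

text \<open>The Bernoulli polynomial of degree \<open>m\<close> divided by \<open>m!\<close>; with this scaling, differentiation just
  lowers the index.\<close>
definition bern_fn :: "nat \<Rightarrow> real \<Rightarrow> real" where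
  "bern_fn m x = (\<Sum>i\<le>m. bernoulli_num (m - i) / (fact (m - i) * fact i) * x ^ i)"

lemma bern_fn_0: "bern_fn m 0 = bernoulli_num m / fact m"
  by (simp add: bern_fn_def power_0_left if_distrib[of "\<lambda>y. _ * y"] sum.delta cong: if_cong)

lemma bern_fn_has_derivative:
  "(bern_fn (Suc m) has_real_derivative bern_fn m x) (at x)"
proof -
  have eq: "bern_fn (Suc m) = (\<lambda>x. bernoulli_num (Suc m) / fact (Suc m) +
      (\<Sum>i\<le>m. bernoulli_num (m - i) / (fact (m - i) * fact (Suc i)) * x ^ Suc i))"
    unfolding bern_fn_def by (subst sum.atMost_Suc_shift) (simp del: fact_Suc)
  have "((\<lambda>x. bernoulli_num (Suc m) / fact (Suc m) +
      (\<Sum>i\<le>m. bernoulli_num (m - i) / (fact (m - i) * fact (Suc i)) * x ^ Suc i))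
      has_real_derivative
      0 + (\<Sum>i\<le>m. bernoulli_num (m - i) / (fact (m - i) * fact (Suc i)) * (real (Suc i) * x ^ i))) (at x)"
    using DERIV_pow[of "Suc _" x] by (intro DERIV_add DERIV_const DERIV_sum DERIV_cmult) simp
  also have "0 + (\<Sum>i\<le>m. bernoulli_num (m - i) / (fact (m - i) * fact (Suc i)) * (real (Suc i) * x ^ i))
      = bern_fn m x"
    unfolding bern_fn_def by (simp only: add_0_left, intro sum.cong refl) (simp add: divide_simps)
  finally show ?thesis unfolding eq .
qed

text \<open>This is the identity \<open>B(\<lambda>) (exp \<lambda> - 1) = \<lambda>\<close> for the generating function \<open>B\<close>, read off at
  the coefficient of \<open>\<lambda>\<^sup>m\<close>.\<close>
lemma bern_fn_1:
  assumes "m \<noteq> 1"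
  shows "bern_fn m 1 = bern_fn m 0"
proof -
  let ?G = "Abs_fps (\<lambda>j. bernoulli_num j / fact j)"
  have "fps_nth (?G * fps_exp 1 - ?G) m = fps_nth fps_X m"
    using bernoulli_num_gf by (simp add: algebra_simps)
  moreover have "fps_nth (?G * fps_exp 1) m = bern_fn m 1"
    unfolding bern_fn_def fps_mult_nth
    by (subst sum.atLeastAtMost_rev, simp add: atMost_atLeast0)
  ultimately show ?thesis using assms by (simp add: bern_fn_0 fps_X_nth)
qed

lemma bernoulli_num_0: "bernoulli_num 0 = 1"
proof -
  let ?G = "Abs_fps (\<lambda>j. bernoulli_num j / fact j)"
  have "fps_nth (?G * (fps_exp 1 - 1)) 1 = 1"
    unfolding bernoulli_num_gf by simp
  thus ?thesis by (simp add: fps_mult_nth_1)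
qed

lemma bernstein_power:
  fixes x :: real
  assumes "i \<le> N"
  shows "x ^ i = (\<Sum>m\<le>N. real (m choose i) / real (N choose i) * (real (N choose m) * x ^ m * (1 - x) ^ (N - m)))"
proof -
  have "(\<Sum>m\<le>N. real (m choose i) / real (N choose i) * (real (N choose m) * x ^ m * (1 - x) ^ (N - m)))
     = (\<Sum>m\<in>{i..N}. real (m choose i) / real (N choose i) * (real (N choose m) * x ^ m * (1 - x) ^ (N - m)))"
    by (intro sum.mono_neutral_right) (auto simp: not_le)
  also have "\<dots> = (\<Sum>m\<in>{i..N}. real ((N - i) choose (m - i)) * x ^ m * (1 - x) ^ (N - m))"
  proof (intro sum.cong refl)
    fix m assume m: "m \<in> {i..N}"
    have "(N choose m) * (m choose i) = (N choose i) * ((N - i) choose (m - i))"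
      using m by (intro choose_mult) auto
    hence "real (N choose m) * real (m choose i) = real (N choose i) * real ((N - i) choose (m - i))"
      by (metis of_nat_mult)
    moreover have "real (N choose i) \<noteq> 0" using assms by simp
    ultimately have "real (m choose i) / real (N choose i) * real (N choose m) = real ((N - i) choose (m - i))"
      by (simp add: field_simps)
    thus "real (m choose i) / real (N choose i) * (real (N choose m) * x ^ m * (1 - x) ^ (N - m))
       = real ((N - i) choose (m - i)) * x ^ m * (1 - x) ^ (N - m)"
      by (simp add: mult.assoc[symmetric])
  qed
  also have "\<dots> = (\<Sum>l\<le>N - i. real ((N - i) choose l) * x ^ (l + i) * (1 - x) ^ (N - i - l))"
    using assms by (intro sum.reindex_bij_witness[of _ "\<lambda>l. l + i" "\<lambda>m. m - i"]) auto
  also have "\<dots> = x ^ i * (\<Sum>l\<le>N - i. real ((N - i) choose l) * x ^ l * (1 - x) ^ (N - i - l))"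
    by (simp add: sum_distrib_left power_add mult_ac)
  also have "\<dots> = x ^ i"
    using binomial_ring[of x "1 - x" "N - i"] by simp
  finally show ?thesis by simp
qed

text \<open>On \<open>(0,1)\<close> divide by \<open>(1 - x)\<^sup>N\<close> and substitute \<open>t = x / (1 - x)\<close>: the difference of the two
  sides becomes a polynomial in \<open>t\<close> that vanishes on the positive half-line.\<close>
lemma bernstein_unique:
  fixes a b :: "nat \<Rightarrow> real"
  assumes eq: "\<And>x. 0 < x \<Longrightarrow> x < 1 \<Longrightarrow>
      (\<Sum>m\<le>N. a m * (real (N choose m) * x ^ m * (1 - x) ^ (N - m))) =
      (\<Sum>m\<le>N. b m * (real (N choose m) * x ^ m * (1 - x) ^ (N - m)))"
    and m: "m \<le> N"
  shows "a m = b m"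
proof -
  define p :: "real poly" where
    "p = (\<Sum>m\<le>N. monom ((a m - b m) * real (N choose m)) m)"
  have root: "poly p t = 0" if "t > 0" for t
  proof -
    define x where "x = t / (1 + t)"
    have x: "0 < x" "x < 1" "1 - x = 1 / (1 + t)" "x = t * (1 - x)"
      using that by (auto simp: x_def field_simps)
    have "poly p t * (1 - x) ^ N = (\<Sum>m\<le>N. (a m - b m) * (real (N choose m) * (x ^ m * (1 - x) ^ (N - m))))"
      unfolding p_def poly_sum poly_monom sum_distrib_right
    proof (intro sum.cong refl)
      fix m assume "m \<in> {..N}"
      hence "(1 - x) ^ N = (1 - x) ^ m * (1 - x) ^ (N - m)"
        by (simp flip: power_add)
      moreover have "x ^ m = t ^ m * (1 - x) ^ m"
        using x(4) by (metis power_mult_distrib)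
      ultimately show "(a m - b m) * real (N choose m) * t ^ m * (1 - x) ^ N
        = (a m - b m) * (real (N choose m) * (x ^ m * (1 - x) ^ (N - m)))" by simp
    qed
    also have "\<dots> = 0"
      using eq[OF x(1,2)] by (simp add: algebra_simps sum_subtractf)
    finally show ?thesis using x(2) by simp
  qed
  have "p = 0"
  proof (rule ccontr)
    assume "p \<noteq> 0"
    hence "finite {t. poly p t = 0}" by (rule poly_roots_finite)
    hence "finite {0<..<(1::real)}" by (rule finite_subset[rotated]) (auto intro: root)
    thus False using infinite_Ioo[of 0 "1::real"] by simp
  qed
  hence "coeff p m = 0" by simp
  thus ?thesis using m by (simp add: p_def coeff_sum)
qed


text \<open>The distribution function on \<open>[0,1]\<close> of the position after \<open>n \<ge> 1\<close> steps of the clock.  At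
  \<open>n = 0\<close> the formula makes no statement about the clock, whose starting position is \<open>0\<close>.\<close>
definition clock_cdf :: "nat \<Rightarrow> real \<Rightarrow> real" where
  "clock_cdf n x = x - 2 ^ n * (bern_fn (Suc n) x - bern_fn (Suc n) 0)"

text \<open>The antiderivative of \<open>clock_cdf n\<close> that vanishes at \<open>0\<close>.\<close>
definition clock_cdf_integral :: "nat \<Rightarrow> real \<Rightarrow> real" where
  "clock_cdf_integral n x = x\<^sup>2 / 2 -
     2 ^ n * (bern_fn (Suc (Suc n)) x - bern_fn (Suc (Suc n)) 0 - x * bern_fn (Suc n) 0)"

lemma clock_cdf_integral_has_derivative:
  "(clock_cdf_integral n has_real_derivative clock_cdf n x) (at x)"
proof -
  have "((\<lambda>x. x\<^sup>2 / 2 -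
     2 ^ n * (bern_fn (Suc (Suc n)) x - bern_fn (Suc (Suc n)) 0 - x * bern_fn (Suc n) 0))
     has_real_derivative clock_cdf n x) (at x)"
    by (auto intro!: derivative_eq_intros bern_fn_has_derivative simp: clock_cdf_def)
  thus ?thesis by (simp add: clock_cdf_integral_def[abs_def])
qed

lemma clock_cdf_integral_0: "clock_cdf_integral n 0 = 0"
  by (simp add: clock_cdf_integral_def)

text \<open>The recursion that the law of the position obeys; the periodicity \<open>b\<^sub>n\<^sub>+\<^sub>2(1) = b\<^sub>n\<^sub>+\<^sub>2(0)\<close>
  is what makes it hold.\<close>
lemma clock_cdf_Suc:
  "clock_cdf (Suc n) x =
     2 * x * (1 - clock_cdf_integral n 1) - x\<^sup>2 + 2 * clock_cdf_integral n x"
  by (simp add: clock_cdf_def clock_cdf_integral_def bern_fn_1 field_simps)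

lemma clock_cdf_1: "clock_cdf (Suc 0) x = 2 * x - x\<^sup>2"
proof -
  have *: "bern_fn (Suc (Suc 0)) y = bernoulli_num 2 / 2 + bernoulli_num 1 * y + y\<^sup>2 / 2" for y
    by (simp add: bern_fn_def bernoulli_num_0 power2_eq_square numeral_2_eq_2)
  have "bernoulli_num 1 = - 1 / 2"
    using bern_fn_1[of "Suc (Suc 0)"] unfolding * by simp
  thus ?thesis by (simp add: clock_cdf_def *)
qed

text \<open>The \<open>m\<close>-th Bernstein coefficient of \<open>clock_cdf n\<close> in degree \<open>2n\<close>, and so the probability that
  the final index is at most \<open>m\<close>.\<close>
definition clock_coeff :: "nat \<Rightarrow> nat \<Rightarrow> real" where
  "clock_coeff n m = real m / (2 * real n) -
     2 ^ n * (\<Sum>i\<le>n. bernoulli_num (n - i) / (fact (n - i) * fact (Suc i)) *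
       (real (m choose Suc i) / real (2 * n choose Suc i)))"

lemma clock_cdf_bernstein:
  assumes "n \<ge> 1"
  shows "clock_cdf n x = (\<Sum>m\<le>2 * n. clock_coeff n m *
           (real (2 * n choose m) * x ^ m * (1 - x) ^ (2 * n - m)))"
proof -
  let ?B = "\<lambda>m. real (2 * n choose m) * x ^ m * (1 - x) ^ (2 * n - m)"
  let ?b = "\<lambda>i. bernoulli_num (n - i) / (fact (n - i) * fact (Suc i))"
  have pow: "x ^ i = (\<Sum>m\<le>2 * n. real (m choose i) / real (2 * n choose i) * ?B m)"
    if "i \<le> 2 * n" for i using bernstein_power[OF that] .
  have "clock_cdf n x = x ^ 1 - 2 ^ n * (\<Sum>i\<le>n. ?b i * x ^ Suc i)"
    unfolding clock_cdf_def bern_fn_def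
    by (subst (1 2) sum.atMost_Suc_shift) (simp del: fact_Suc)
  also have "\<dots> = (\<Sum>m\<le>2 * n. real m / (2 * real n) * ?B m)
      - 2 ^ n * (\<Sum>i\<le>n. ?b i * (\<Sum>m\<le>2 * n. real (m choose Suc i) / real (2 * n choose Suc i) * ?B m))"
  proof (intro arg_cong2[where f = "(-)"] arg_cong2[where f = "(*)"] sum.cong refl)
    show "x ^ 1 = (\<Sum>m\<le>2 * n. real m / (2 * real n) * ?B m)"
      using assms by (subst pow) simp_all
    show "x ^ Suc i = (\<Sum>m\<le>2 * n. real (m choose Suc i) / real (2 * n choose Suc i) * ?B m)"
      if "i \<in> {..n}" for i
      by (rule pow) (use that assms in auto)
  qed
  also have "(\<Sum>i\<le>n. ?b i * (\<Sum>m\<le>2 * n. real (m choose Suc i) / real (2 * n choose Suc i) * ?B m))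
      = (\<Sum>m\<le>2 * n. (\<Sum>i\<le>n. ?b i * (real (m choose Suc i) / real (2 * n choose Suc i))) * ?B m)"
    unfolding sum_distrib_left sum_distrib_right by (subst sum.swap) (simp only: mult.assoc)
  finally show ?thesis
    by (simp only: clock_coeff_def left_diff_distrib sum_subtractf mult.assoc
        sum_distrib_left[where A = "{..2 * n}"])
qed

lemma clock_coeff_diff:
  assumes n: "n \<ge> 1" and k: "k \<ge> 1"
  shows "clock_coeff n k - clock_coeff n (k - 1) = 1 / (2 * real n) - clock_delta n k"
proof -
  obtain l where l: "k = Suc l" using k by (cases k) auto
  have summand: "bernoulli_num (n - i) / (fact (n - i) * fact (Suc i)) * (real (l choose i) / real (2 * n choose Suc i))
      = (real (l choose i) * real (n choose i) / real ((2 * n - 1) choose i) * bernoulli_num (n - i)) /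
        (2 * real n * fact n)" if i: "i \<le> n" for i
  proof -
    have "Suc i * (2 * n choose Suc i) = 2 * n * ((2 * n - 1) choose i)"
      using binomial_absorption[of i "2 * n"] n by simp
    hence c: "real (Suc i) * real (2 * n choose Suc i) = 2 * real n * real ((2 * n - 1) choose i)"
      by (metis of_nat_mult of_nat_numeral)
    have f: "real (n choose i) = fact n / (fact i * fact (n - i))"
      using i by (rule binomial_fact)
    have nz: "real ((2 * n - 1) choose i) \<noteq> 0" "real (2 * n choose Suc i) \<noteq> 0"
      using n i by auto
    have "real (2 * n choose Suc i) = 2 * real n * real ((2 * n - 1) choose i) / real (Suc i)"
      using c by (simp add: field_simps del: of_nat_Suc binomial_Suc_Suc)
    thus ?thesis using nz n unfolding f fact_Suc
      by (auto simp: divide_simps mult_ac simp del: of_nat_Suc binomial_Suc_Suc)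
  qed
  have "clock_coeff n k - clock_coeff n (k - 1) = 1 / (2 * real n) -
      2 ^ n * (\<Sum>i\<le>n. bernoulli_num (n - i) / (fact (n - i) * fact (Suc i)) * (real (l choose i) / real (2 * n choose Suc i)))"
    unfolding clock_coeff_def l
    by (simp add: add_divide_distrib ring_distribs sum.distrib del: fact_Suc)
  also have "(\<Sum>i\<le>n. bernoulli_num (n - i) / (fact (n - i) * fact (Suc i)) * (real (l choose i) / real (2 * n choose Suc i)))
     = (\<Sum>i\<le>n. (real (l choose i) * real (n choose i) / real ((2 * n - 1) choose i) * bernoulli_num (n - i)) /
        (2 * real n * fact n))"
    by (intro sum.cong refl summand) simp
  also have "2 ^ n * \<dots> = clock_delta n k"
  proof -
    have "(2::real) ^ n = 2 * 2 ^ (n - 1)" using n by (simp flip: power_Suc)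
    thus ?thesis
      unfolding sum_divide_distrib[symmetric]
      by (simp add: clock_delta_def l atMost_atLeast0)
  qed
  finally show ?thesis .
qed

section \<open>Relative order is independent of symmetric functions\<close>

text \<open>The relative order of the values of \<open>w\<close> on \<open>D\<close>, ties included: two indices carry equal values
  iff neither pair formed from them belongs to the pattern.\<close>
definition order_pattern :: "'i set \<Rightarrow> ('i \<Rightarrow> real) \<Rightarrow> ('i \<times> 'i) set" where
  "order_pattern D w = {(i, j). i \<in> D \<and> j \<in> D \<and> w i < w j}"

lemma order_pattern_iff:
  "(i, j) \<in> order_pattern D w \<longleftrightarrow> i \<in> D \<and> j \<in> D \<and> w i < w j"
  by (simp add: order_pattern_def)

text \<open>There are only finitely many patterns, so no measurability of \<open>P\<close> needs to be assumed.\<close>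
lemma order_pattern_measurable:
  assumes D: "finite D"
    and P: "\<And>w w'. order_pattern D w = order_pattern D w' \<Longrightarrow> P w = P w'"
  shows "{w \<in> space (Pi\<^sub>M D (\<lambda>_. borel)). P w} \<in> sets (Pi\<^sub>M D (\<lambda>_. borel))"
proof -
  let ?S = "Pi\<^sub>M D (\<lambda>_. borel :: real measure)"
  define \<T> where "\<T> = order_pattern D ` Collect P"
  have fin: "finite \<T>" unfolding \<T>_def
    by (rule finite_subset[of _ "Pow (D \<times> D)"]) (use D in \<open>auto simp: order_pattern_def\<close>)
  have eq: "order_pattern D w = T \<longleftrightarrow>
      (\<forall>i\<in>D. \<forall>j\<in>D. (w i < w j) = ((i, j) \<in> T))" if "T \<in> \<T>" for T w
  proof -
    have "T \<subseteq> D \<times> D" using that by (auto simp: \<T>_def order_pattern_def)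
    thus ?thesis by (auto simp: order_pattern_def)
  qed
  have "P w \<longleftrightarrow> (\<exists>T\<in>\<T>. order_pattern D w = T)" for w
    unfolding \<T>_def using P[of w] by blast
  moreover have "(\<exists>T\<in>\<T>. order_pattern D w = T) \<longleftrightarrow> (\<exists>T\<in>\<T>. \<forall>i\<in>D. \<forall>j\<in>D. (w i < w j) = ((i, j) \<in> T))" for w
    by (rule bex_cong[OF refl eq])
  ultimately have "{w \<in> space ?S. P w} =
      (\<Union>T\<in>\<T>. {w \<in> space ?S. \<forall>i\<in>D. \<forall>j\<in>D. (w i < w j) = ((i, j) \<in> T)})"
    by (simp only:) blast
  also have "\<dots> \<in> sets ?S"
  proof (intro sets.finite_UN fin)
    fix T
    show "{w \<in> space ?S. \<forall>i\<in>D. \<forall>j\<in>D. (w i < w j) = ((i, j) \<in> T)} \<in> sets ?S"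
      using D by measurable
  qed
  finally show ?thesis .
qed

lemma ex_permutation_same_pattern:
  fixes w w' :: "'i \<Rightarrow> real"
  assumes D: "finite D" and inj: "inj_on w D" "inj_on w' D"
  shows "\<exists>\<tau>. \<tau> permutes D \<and> order_pattern D (w' \<circ> \<tau>) = order_pattern D w"
proof -
  \<comment> \<open>match indices of equal rank\<close>
  define r where "r w i = card {j \<in> D. w j < w i}" for w :: "'i \<Rightarrow> real" and i
  have r_less: "r w i < r w j" if "i \<in> D" "w i < w j" for w i j
    unfolding r_def using that D by (intro psubset_card_mono) auto
  have bij: "bij_betw (r w) D {..<card D}" if "inj_on w D" for w
  proof -
    have "inj_on (r w) D"
    proof (rule inj_onI)
      fix i j assume *: "i \<in> D" "j \<in> D" "r w i = r w j"
      hence "w i = w j" using r_less[of i w j] r_less[of j w i] by (cases "w i" "w j" rule: linorder_cases) auto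
      thus "i = j" using * that by (auto dest: inj_onD)
    qed
    moreover have "r w ` D \<subseteq> {..<card D}"
      unfolding r_def using D by (auto intro!: psubset_card_mono)
    ultimately show ?thesis
      by (simp add: bij_betw_def card_image card_subset_eq)
  qed
  define \<tau> where "\<tau> i = (if i \<in> D then inv_into D (r w') (r w i) else i)" for i
  have "bij_betw (inv_into D (r w') \<circ> r w) D D"
    using bij[OF inj(1)] bij_betw_inv_into[OF bij[OF inj(2)]] by (rule bij_betw_trans)
  hence "bij_betw \<tau> D D" by (subst bij_betw_cong[where g = "inv_into D (r w') \<circ> r w"]) (auto simp: \<tau>_def)
  hence perm: "\<tau> permutes D" by (rule bij_imp_permutes) (simp add: \<tau>_def)
  have r_\<tau>: "r w' (\<tau> i) = r w i" if "i \<in> D" for i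
    using that bij[OF inj(2)] bij_betwE[OF bij[OF inj(1)]]
    by (auto simp: \<tau>_def bij_betw_def intro!: f_inv_into_f)
  have r_iff: "r w i < r w j \<longleftrightarrow> w i < w j" if "i \<in> D" "j \<in> D" for w i j
  proof
    assume *: "r w i < r w j"
    show "w i < w j"
    proof (rule ccontr)
      assume "\<not> w i < w j"
      hence "{l \<in> D. w l < w j} \<subseteq> {l \<in> D. w l < w i}" by auto
      hence "r w j \<le> r w i" unfolding r_def using D by (intro card_mono) auto
      thus False using * by simp
    qed
  qed (use that r_less in auto)
  have "w' (\<tau> i) < w' (\<tau> j) \<longleftrightarrow> w i < w j" if "i \<in> D" "j \<in> D" for i j
    using that r_iff[of "\<tau> i" "\<tau> j" w'] r_iff[of i j w] r_\<tau> permutes_in_image[OF perm] by simp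
  thus ?thesis using perm by (auto simp: order_pattern_def)
qed

lemma order_pattern_comp:
  assumes "\<pi> permutes D" "order_pattern D w = order_pattern D w'"
  shows "order_pattern D (w \<circ> \<pi>) = order_pattern D (w' \<circ> \<pi>)"
proof -
  have "w (\<pi> i) < w (\<pi> j) \<longleftrightarrow> w' (\<pi> i) < w' (\<pi> j)" if "i \<in> D" "j \<in> D" for i j
    using that assms(2) permutes_in_image[OF assms(1)] order_pattern_iff[of "\<pi> i" "\<pi> j" D] by auto
  thus ?thesis by (auto simp: order_pattern_def)
qed

text \<open>The law of \<open>w\<close> is invariant under permutations of the coordinates, so the indicator of the event
  \<open>P\<close> may be averaged over all of them without affecting the joint probability with the symmetric
  event \<open>Q\<close>.  The average does not depend on \<open>w\<close> as long as the values are distinct, because any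
  two such points have the same pattern up to a permutation.\<close>
lemma pattern_indep_symmetric:
  fixes \<mu> :: "real measure" and D :: "'i set"
  defines "\<Omega> \<equiv> Pi\<^sub>M D (\<lambda>_. \<mu>)"
  assumes D: "finite D" and \<mu>: "prob_space \<mu>" and sets_\<mu>: "sets \<mu> = sets borel"
    and distinct: "AE w in \<Omega>. inj_on w D"
    and P: "\<And>w w'. order_pattern D w = order_pattern D w' \<Longrightarrow> P w = P w'"
    and Q: "{w \<in> space \<Omega>. Q w} \<in> sets \<Omega>"
    and Q_sym: "\<And>w \<pi>. \<pi> permutes D \<Longrightarrow> w \<in> space \<Omega> \<Longrightarrow> Q (\<lambda>i\<in>D. w (\<pi> i)) = Q w"
  shows "measure \<Omega> {w \<in> space \<Omega>. P w \<and> Q w} =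
         measure \<Omega> {w \<in> space \<Omega>. P w} * measure \<Omega> {w \<in> space \<Omega>. Q w}"
proof -
  interpret prob_space \<Omega> unfolding \<Omega>_def by (intro prob_space_PiM \<mu>)
  have sets_\<Omega>: "sets \<Omega> = sets (Pi\<^sub>M D (\<lambda>_. borel))"
    unfolding \<Omega>_def by (intro sets_PiM_cong sets_\<mu> refl)
  have space_\<Omega>: "space \<Omega> = space (Pi\<^sub>M D (\<lambda>_. borel))"
    using sets_\<Omega> by (rule sets_eq_imp_space_eq)
  have P_meas: "{w \<in> space \<Omega>. P' w} \<in> sets \<Omega>"
    if "\<And>w w'. order_pattern D w = order_pattern D w' \<Longrightarrow> P' w = P' w'" for P'
    unfolding sets_\<Omega> space_\<Omega> using D that by (rule order_pattern_measurable)
  obtain w\<^sub>0 :: "'i \<Rightarrow> real" where w\<^sub>0: "inj_on w\<^sub>0 D"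
  proof -
    have False if "\<And>w :: 'i \<Rightarrow> real. \<not> inj_on w D"
    proof -
      have "AE w in \<Omega>. False"
        using distinct by eventually_elim (use that in blast)
      thus False by simp
    qed
    thus ?thesis using that by blast
  qed
  define perms where "perms = {\<pi>. \<pi> permutes D}"
  have fin: "finite perms" unfolding perms_def by (rule finite_permutations[OF D])
  define K where "K = real (card {\<pi> \<in> perms. P (w\<^sub>0 \<circ> \<pi>)})"
  have count: "real (card {\<pi> \<in> perms. P (w \<circ> \<pi>)}) = K" if w: "inj_on w D" for w
  proof -
    obtain \<tau> where \<tau>: "\<tau> permutes D" "order_pattern D (w \<circ> \<tau>) = order_pattern D w\<^sub>0"
      using ex_permutation_same_pattern[OF D w\<^sub>0 w] by blast
    have iff: "P (w \<circ> (\<tau> \<circ> \<pi>)) = P (w\<^sub>0 \<circ> \<pi>)" if "\<pi> permutes D" for \<pi>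
      using P[OF order_pattern_comp[OF that \<tau>(2)]] by (simp add: comp_assoc)
    have "bij_betw (\<lambda>\<pi>. \<tau> \<circ> \<pi>) {\<pi> \<in> perms. P (w\<^sub>0 \<circ> \<pi>)} {\<pi> \<in> perms. P (w \<circ> \<pi>)}"
    proof (rule bij_betwI[where g = "\<lambda>\<pi>. inv \<tau> \<circ> \<pi>"])
      show "(\<lambda>\<pi>. \<tau> \<circ> \<pi>) \<in> {\<pi> \<in> perms. P (w\<^sub>0 \<circ> \<pi>)} \<rightarrow> {\<pi> \<in> perms. P (w \<circ> \<pi>)}"
        using iff \<tau>(1) by (auto simp: perms_def intro: permutes_compose)
      show "(\<lambda>\<pi>. inv \<tau> \<circ> \<pi>) \<in> {\<pi> \<in> perms. P (w \<circ> \<pi>)} \<rightarrow> {\<pi> \<in> perms. P (w\<^sub>0 \<circ> \<pi>)}"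
      proof
        fix \<pi> assume \<pi>: "\<pi> \<in> {\<pi> \<in> perms. P (w \<circ> \<pi>)}"
        hence "(inv \<tau> \<circ> \<pi>) permutes D"
          using \<tau>(1) by (auto simp: perms_def intro: permutes_compose permutes_inv)
        moreover have "\<tau> \<circ> (inv \<tau> \<circ> \<pi>) = \<pi>"
          using permutes_inv_o(1)[OF \<tau>(1)] by (simp add: comp_assoc[symmetric])
        ultimately show "inv \<tau> \<circ> \<pi> \<in> {\<pi> \<in> perms. P (w\<^sub>0 \<circ> \<pi>)}"
          using iff[of "inv \<tau> \<circ> \<pi>"] \<pi> by (simp add: perms_def)
      qed
    qed (use permutes_inv_o[OF \<tau>(1)] in \<open>simp_all add: comp_assoc[symmetric]\<close>)
    thus ?thesis by (simp add: K_def bij_betw_same_card)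
  qed
  \<comment> \<open>used for the symmetric event \<open>Q\<close> and for the sure event\<close>
  have average: "fact (card D) * measure \<Omega> {w \<in> space \<Omega>. P w \<and> Q' w} = K * measure \<Omega> {w \<in> space \<Omega>. Q' w}"
    if Q': "{w \<in> space \<Omega>. Q' w} \<in> sets \<Omega>"
      and sym: "\<And>w \<pi>. \<pi> permutes D \<Longrightarrow> w \<in> space \<Omega> \<Longrightarrow> Q' (\<lambda>i\<in>D. w (\<pi> i)) = Q' w" for Q'
  proof -
    have P_comp: "{w \<in> space \<Omega>. P (w \<circ> \<pi>)} \<in> sets \<Omega>" if "\<pi> permutes D" for \<pi>
      by (rule P_meas, rule P, rule order_pattern_comp[OF that])
    have both: "{w \<in> space \<Omega>. P (w \<circ> \<pi>) \<and> Q' w} \<in> sets \<Omega>" if "\<pi> permutes D" for \<pi>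
    proof -
      have "{w \<in> space \<Omega>. P (w \<circ> \<pi>) \<and> Q' w} =
          {w \<in> space \<Omega>. P (w \<circ> \<pi>)} \<inter> {w \<in> space \<Omega>. Q' w}" by auto
      thus ?thesis using P_comp[OF that] Q' by simp
    qed
    have inv: "measure \<Omega> {w \<in> space \<Omega>. P w \<and> Q' w} = measure \<Omega> {w \<in> space \<Omega>. P (w \<circ> \<pi>) \<and> Q' w}"
      if \<pi>: "\<pi> permutes D" for \<pi>
    proof -
      let ?t = "\<lambda>w. \<lambda>i\<in>D. w (\<pi> i)"
      have img: "\<pi> i \<in> D" if "i \<in> D" for i using permutes_in_image[OF \<pi>] that by simp
      have t: "?t \<in> measurable \<Omega> \<Omega>"
        unfolding \<Omega>_def by (intro measurable_restrict measurable_component_singleton img)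
      have "distr \<Omega> \<Omega> ?t = \<Omega>"
        unfolding \<Omega>_def by (rule distr_PiM_reindex) (use \<mu> img permutes_inj_on[OF \<pi>] in auto)
      hence "measure \<Omega> {w \<in> space \<Omega>. P w \<and> Q' w} = measure (distr \<Omega> \<Omega> ?t) {w \<in> space \<Omega>. P w \<and> Q' w}"
        by simp
      also have "\<dots> = measure \<Omega> (?t -` {w \<in> space \<Omega>. P w \<and> Q' w} \<inter> space \<Omega>)"
        using both[OF permutes_id] by (intro measure_distr t) simp
      also have "?t -` {w \<in> space \<Omega>. P w \<and> Q' w} \<inter> space \<Omega> = {w \<in> space \<Omega>. P (w \<circ> \<pi>) \<and> Q' w}"
      proof -
        have "P (?t w) = P (w \<circ> \<pi>)" for w
          by (rule P) (auto simp: order_pattern_def)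
        thus ?thesis using sym[OF \<pi>] measurable_space[OF t] by auto
      qed
      finally show ?thesis .
    qed
    have "fact (card D) * measure \<Omega> {w \<in> space \<Omega>. P w \<and> Q' w}
        = (\<Sum>\<pi>\<in>perms. measure \<Omega> {w \<in> space \<Omega>. P w \<and> Q' w})"
      using card_permutations[OF refl D] by (simp add: perms_def)
    also have "\<dots> = (\<Sum>\<pi>\<in>perms. measure \<Omega> {w \<in> space \<Omega>. P (w \<circ> \<pi>) \<and> Q' w})"
      by (intro sum.cong refl inv) (simp add: perms_def)
    also have "\<dots> = (\<Sum>\<pi>\<in>perms. \<integral>w. indicator {w \<in> space \<Omega>. P (w \<circ> \<pi>) \<and> Q' w} w \<partial>\<Omega>)"
      by (intro sum.cong refl) (simp add: both perms_def)
    also have "\<dots> = (\<integral>w. (\<Sum>\<pi>\<in>perms. indicator {w \<in> space \<Omega>. P (w \<circ> \<pi>) \<and> Q' w} w) \<partial>\<Omega>)"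
      by (rule Bochner_Integration.integral_sum[symmetric])
         (use both in \<open>auto simp: perms_def intro!: integrable_real_indicator simp: emeasure_eq_measure\<close>)
    also have "\<dots> = (\<integral>w. K * indicator {w \<in> space \<Omega>. Q' w} w \<partial>\<Omega>)"
    proof (rule integral_cong_AE)
      show "AE w in \<Omega>. (\<Sum>\<pi>\<in>perms. indicator {w \<in> space \<Omega>. P (w \<circ> \<pi>) \<and> Q' w} w)
          = K * indicator {w \<in> space \<Omega>. Q' w} w"
        using distinct AE_space
      proof eventually_elim
        case (elim w)
        have "(\<Sum>\<pi>\<in>perms. indicator {w \<in> space \<Omega>. P (w \<circ> \<pi>) \<and> Q' w} w :: real)
            = (\<Sum>\<pi>\<in>perms. if P (w \<circ> \<pi>) then indicator {w \<in> space \<Omega>. Q' w} w else 0)"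
          using elim(2) by (intro sum.cong refl) (auto simp: indicator_def)
        also have "\<dots> = K * indicator {w \<in> space \<Omega>. Q' w} w"
          using fin by (simp add: count[OF elim(1), symmetric] flip: sum.inter_filter)
        finally show ?case .
      qed
    next
      show "(\<lambda>w. \<Sum>\<pi>\<in>perms. indicator {w \<in> space \<Omega>. P (w \<circ> \<pi>) \<and> Q' w} w :: real) \<in> borel_measurable \<Omega>"
        using both by (intro borel_measurable_sum borel_measurable_indicator) (simp add: perms_def)
      show "(\<lambda>w. K * indicator {w \<in> space \<Omega>. Q' w} w) \<in> borel_measurable \<Omega>"
        using Q' by (intro borel_measurable_times borel_measurable_indicator borel_measurable_const)
    qed
    also have "\<dots> = K * measure \<Omega> {w \<in> space \<Omega>. Q' w}"
      using Q' by simp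
    finally show ?thesis .
  qed
  have "fact (card D) * measure \<Omega> {w \<in> space \<Omega>. P w} = K"
    using average[of "\<lambda>_. True"] prob_space by simp
  hence "fact (card D) * measure \<Omega> {w \<in> space \<Omega>. P w \<and> Q w} =
      fact (card D) * (measure \<Omega> {w \<in> space \<Omega>. P w} * measure \<Omega> {w \<in> space \<Omega>. Q w})"
    using average[of Q] Q Q_sym by simp
  thus ?thesis by simp
qed

section \<open>The clock in terms of relative order\<close>

text \<open>Starting from \<open>p\<close> and moving clockwise on \<open>[0,1)\<close>, the point \<open>a\<close> is met no later than \<open>b\<close>.
  The condition refers only to the order of the three numbers.\<close>
definition clockwise_le :: "real \<Rightarrow> real \<Rightarrow> real \<Rightarrow> bool" where
  "clockwise_le p a b \<longleftrightarrow> (if p \<le> a then b < p \<or> a \<le> b else b < p \<and> a \<le> b)"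

lemma frac_diff_unit:
  fixes p a :: real
  assumes "p \<in> {0..<1}" "a \<in> {0..<1}"
  shows "frac (a - p) = (if p \<le> a then a - p else a - p + 1)"
proof (cases "p \<le> a")
  case True
  thus ?thesis using assms by (subst frac_unique_iff) auto
next
  case False
  have "a - p - (a - p + 1) = of_int (- 1)" by simp
  hence "a - p - (a - p + 1) \<in> \<int>" using Ints_of_int by metis
  thus ?thesis using False assms by (subst frac_unique_iff) auto
qed

lemma frac_le_iff_clockwise_le:
  assumes "p \<in> {0..<1}" "a \<in> {0..<1}" "b \<in> {0..<1}"
  shows "frac (a - p) \<le> frac (b - p) \<longleftrightarrow> clockwise_le p a b"
  using assms by (auto simp: frac_diff_unit clockwise_le_def)

text \<open>The \<open>2n\<close> points are labelled by pair number and a Boolean that tells the second point of a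
  pair (\<open>True\<close>) from the first.\<close>
abbreviation clock_labels :: "nat \<Rightarrow> (nat \<times> bool) set" where
  "clock_labels n \<equiv> {1..n} \<times> UNIV"

text \<open>The label of the point reached at step \<open>k\<close>.  The value at \<open>k = 0\<close> is a dummy: the starting
  position \<open>0\<close> carries no label, and from there the smaller point of a pair is met
  first.  The definition uses only comparisons between points, so it makes sense for arbitrary reals.\<close>
primrec clock_label :: "(nat \<times> bool \<Rightarrow> real) \<Rightarrow> nat \<Rightarrow> nat \<times> bool" where
  "clock_label w 0 = (0, False)"
| "clock_label w (Suc k) = (Suc k, \<not>
     (if k = 0 then w (1, False) \<le> w (1, True)
      else clockwise_le (w (clock_label w k)) (w (Suc k, False)) (w (Suc k, True))))"

lemma clock_label_in: "1 \<le> k \<Longrightarrow> k \<le> n \<Longrightarrow> clock_label w k \<in> clock_labels n"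
  by (cases k) auto

lemma clock_pos_eq_label:
  assumes w: "\<And>j. j \<in> clock_labels n \<Longrightarrow> w j \<in> {0..<1}" and "1 \<le> k" "k \<le> n"
  shows "clock_pos (\<lambda>i. w (i, False)) (\<lambda>i. w (i, True)) k = w (clock_label w k)"
  using assms(2,3)
proof (induction k)
  case (Suc k)
  have w': "w (Suc k, False) \<in> {0..<1}" "w (Suc k, True) \<in> {0..<1}"
    using w Suc.prems by auto
  show ?case
  proof (cases "k = 0")
    case True
    thus ?thesis using w' by (simp add: frac_eq)
  next
    case False
    have "w (clock_label w k) \<in> {0..<1}"
      using False Suc.prems by (intro w clock_label_in) auto
    thus ?thesis using False Suc w' frac_le_iff_clockwise_le by auto
  qed
qed simp

lemma clock_label_cong_pattern:
  assumes "order_pattern (clock_labels n) w = order_pattern (clock_labels n) w'"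
    and "k \<le> n"
  shows "clock_label w k = clock_label w' k"
  using assms(2)
proof (induction k)
  case (Suc k)
  have less: "w i < w j \<longleftrightarrow> w' i < w' j" if "i \<in> clock_labels n" "j \<in> clock_labels n" for i j
    using order_pattern_iff[of i j "clock_labels n"] assms(1) that by auto
  have le: "w i \<le> w j \<longleftrightarrow> w' i \<le> w' j" if "i \<in> clock_labels n" "j \<in> clock_labels n" for i j
    using less[OF that(2,1)] by (simp add: linorder_not_less[symmetric])
  have IH: "clock_label w k = clock_label w' k" using Suc by simp
  have in1: "(Suc k, b) \<in> clock_labels n" for b using Suc.prems by auto
  show ?case
  proof (cases "k = 0")
    case True
    thus ?thesis using le in1 by simp
  next
    case False
    have "clock_label w' k \<in> clock_labels n"
      using False Suc.prems by (intro clock_label_in) auto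
    thus ?thesis using False IH less le in1 by (simp add: clockwise_le_def)
  qed
qed simp

text \<open>The final index of the clock: one plus the number of points strictly below the final one.\<close>
definition clock_rank :: "nat \<Rightarrow> (nat \<times> bool \<Rightarrow> real) \<Rightarrow> nat" where
  "clock_rank n w = Suc (card {j \<in> clock_labels n. w j < w (clock_label w n)})"

lemma clock_rank_cong_pattern:
  assumes "n \<ge> 1" "order_pattern (clock_labels n) w = order_pattern (clock_labels n) w'"
  shows "clock_rank n w = clock_rank n w'"
proof -
  have "clock_label w n = clock_label w' n"
    using assms(2) by (rule clock_label_cong_pattern) simp
  moreover have "w i < w j \<longleftrightarrow> w' i < w' j" if "i \<in> clock_labels n" "j \<in> clock_labels n" for i j
    using order_pattern_iff[of i j "clock_labels n"] assms(2) that by auto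
  ultimately have "{j \<in> clock_labels n. w j < w (clock_label w n)} =
      {j \<in> clock_labels n. w' j < w' (clock_label w' n)}"
    using clock_label_in[of n n w'] assms(1) by auto
  thus ?thesis by (simp add: clock_rank_def)
qed

text \<open>The final point is at most \<open>x\<close> iff its index does not exceed the number of points up to \<open>x\<close>; this
  holds even in the presence of ties.\<close>
lemma clock_rank_le_iff:
  assumes "n \<ge> 1"
  shows "clock_rank n w \<le> card {j \<in> clock_labels n. w j \<le> x} \<longleftrightarrow> w (clock_label w n) \<le> x"
proof
  assume le: "w (clock_label w n) \<le> x"
  have "{j \<in> clock_labels n. w j < w (clock_label w n)} \<subset> {j \<in> clock_labels n. w j \<le> x}"
    using le clock_label_in[of n n w] assms by auto
  thus "clock_rank n w \<le> card {j \<in> clock_labels n. w j \<le> x}"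
    unfolding clock_rank_def Suc_le_eq by (intro psubset_card_mono) auto
next
  assume *: "clock_rank n w \<le> card {j \<in> clock_labels n. w j \<le> x}"
  show "w (clock_label w n) \<le> x"
  proof (rule ccontr)
    assume "\<not> w (clock_label w n) \<le> x"
    hence "card {j \<in> clock_labels n. w j \<le> x} \<le> card {j \<in> clock_labels n. w j < w (clock_label w n)}"
      by (intro card_mono) auto
    thus False using * by (simp add: clock_rank_def)
  qed
qed

text \<open>Positions in the sorted list are counted from \<open>1\<close>; the least one holding \<open>y\<close> is preceded exactly by
  the entries below \<open>y\<close>.\<close>
lemma Least_sort_position:
  fixes y :: "'b :: linorder"
  assumes "y \<in> set ys"
  shows "(LEAST i. i \<in> {1..length ys} \<and> y = sort ys ! (i - 1)) =
         Suc (length (filter (\<lambda>z. z < y) ys))"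
proof -
  define s where "s = sort ys"
  define l where "l = length (takeWhile (\<lambda>z. z < y) s)"
  have s: "sorted s" "length s = length ys" by (simp_all add: s_def)
  obtain m where m: "m < length s" "s ! m = y"
    using assms by (metis in_set_conv_nth s_def set_sort)
  have below: "s ! i < y" if "i < l" for i
    using that nth_mem[of i "takeWhile (\<lambda>z. z < y) s"] takeWhile_nth[of i "\<lambda>z. z < y" s]
      set_takeWhileD[of "s ! i" "\<lambda>z. z < y" s] by (simp add: l_def)
  have lm: "l \<le> m" using below[of m] m by (meson not_le order_less_irrefl)
  have "\<not> s ! l < y"
    using nth_length_takeWhile[of "\<lambda>z. z < y" s] lm m by (simp add: l_def)
  moreover have "s ! l \<le> y" using sorted_nth_mono[OF s(1) lm m(1)] m by simp
  ultimately have sl: "s ! l = y" by simp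
  have "z \<ge> y" if "z \<in> set (dropWhile (\<lambda>z. z < y) s)" for z
  proof -
    have "dropWhile (\<lambda>z. z < y) s = drop l s"
      by (simp add: l_def dropWhile_eq_drop)
    then obtain i where i: "i < length s - l" "z = s ! (l + i)"
      using \<open>z \<in> _\<close> by (auto simp: in_set_conv_nth)
    thus ?thesis using sorted_nth_mono[OF s(1), of l "l + i"] sl by auto
  qed
  hence empty: "filter (\<lambda>z. z < y) (dropWhile (\<lambda>z. z < y) s) = []"
    unfolding filter_empty_conv not_less by blast
  have full: "filter (\<lambda>z. z < y) (takeWhile (\<lambda>z. z < y) s) = takeWhile (\<lambda>z. z < y) s"
    by (auto simp: filter_id_conv dest: set_takeWhileD)
  have "filter (\<lambda>z. z < y) s =
      filter (\<lambda>z. z < y) (takeWhile (\<lambda>z. z < y) s @ dropWhile (\<lambda>z. z < y) s)" by simp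
  also have "\<dots> = takeWhile (\<lambda>z. z < y) s"
    unfolding filter_append empty full by (rule append_Nil2)
  finally have "l = length (filter (\<lambda>z. z < y) s)" by (simp only: l_def)
  hence l_eq: "l = length (filter (\<lambda>z. z < y) ys)" by (simp only: s_def filter_sort length_sort)
  show ?thesis unfolding s_def[symmetric] l_eq[symmetric]
  proof (rule Least_equality)
    show "Suc l \<in> {1..length ys} \<and> y = s ! (Suc l - 1)" using lm m(1) sl s(2) by simp
    fix i assume i: "i \<in> {1..length ys} \<and> y = s ! (i - 1)"
    have "\<not> i - 1 < l"
    proof
      assume "i - 1 < l"
      hence "s ! (i - 1) < y" by (rule below)
      thus False using i by simp
    qed
    moreover have "1 \<le> i" using i by simp
    ultimately show "Suc l \<le> i" by linarith
  qed
qed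

lemma clock_index_eq_rank:
  assumes n: "n \<ge> 1" and w: "\<And>j. j \<in> clock_labels n \<Longrightarrow> w j \<in> {0..<1}"
  shows "clock_index n (\<lambda>i. w (i, False)) (\<lambda>i. w (i, True)) n = clock_rank n w"
proof -
  define ys where "ys = map (\<lambda>i. w (i, False)) [1..<n+1] @ map (\<lambda>i. w (i, True)) [1..<n+1]"
  define y where "y = w (clock_label w n)"
  have pos: "clock_pos (\<lambda>i. w (i, False)) (\<lambda>i. w (i, True)) n = y"
    unfolding y_def using w n by (intro clock_pos_eq_label) auto
  obtain i b where ib: "clock_label w n = (i, b)" "i \<in> {1..n}"
    using clock_label_in[of n n w] n by (cases "clock_label w n") auto
  have "set [1..<n+1] = {1..n}" by auto
  hence "set ys = (\<lambda>i. w (i, False)) ` {1..n} \<union> (\<lambda>i. w (i, True)) ` {1..n}"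
    by (simp only: ys_def set_append set_map)
  hence y: "y \<in> set ys" using ib by (cases b) (auto simp: y_def)
  let ?A = "\<lambda>b. {i \<in> {1..n}. w (i, b) < y}"
  have "length (filter (\<lambda>z. z < y) ys) = card (?A False) + card (?A True)"
    by (auto simp: ys_def filter_map distinct_length_filter intro!: arg_cong2[where f = "(+)"] arg_cong[where f = card])
  also have "\<dots> = card ((\<lambda>i. (i, False)) ` ?A False) + card ((\<lambda>i. (i, True)) ` ?A True)"
    by (simp add: card_image inj_on_def)
  also have "\<dots> = card ((\<lambda>i. (i, False)) ` ?A False \<union> (\<lambda>i. (i, True)) ` ?A True)"
    by (intro card_Un_disjoint[symmetric]) auto
  also have "(\<lambda>i. (i, False)) ` ?A False \<union> (\<lambda>i. (i, True)) ` ?A True = {j \<in> clock_labels n. w j < y}"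
  proof (rule set_eqI)
    fix j :: "nat \<times> bool"
    show "j \<in> (\<lambda>i. (i, False)) ` ?A False \<union> (\<lambda>i. (i, True)) ` ?A True \<longleftrightarrow>
        j \<in> {j \<in> clock_labels n. w j < y}"
      by (cases j; cases "snd j") auto
  qed
  finally have "length (filter (\<lambda>z. z < y) ys) = card {j \<in> clock_labels n. w j < y}" .
  moreover have "length ys = 2 * n" by (simp add: ys_def)
  moreover have "clock_index n (\<lambda>i. w (i, False)) (\<lambda>i. w (i, True)) n =
      (LEAST i. i \<in> {1..2 * n} \<and> y = sort ys ! (i - 1))"
    by (simp only: clock_index_def order_stat_def pos ys_def)
  ultimately show ?thesis
    using Least_sort_position[OF y] by (simp only: clock_rank_def y_def)
qed

section \<open>Uniform points and independence\<close>

abbreviation unif :: "real measure" where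
  "unif \<equiv> uniform_measure lborel {0..<1}"

lemma prob_space_unif: "prob_space unif"
  by (rule prob_space_uniform_measure) auto

lemma measure_unif: "A \<in> sets borel \<Longrightarrow> measure unif A = measure lborel ({0..<1} \<inter> A)"
  by (subst measure_uniform_measure) auto

lemma measure_unif_ivl:
  fixes a b :: real
  assumes "0 \<le> a" "a \<le> b" "b \<le> 1"
  shows "measure unif {a..b} = b - a" "measure unif {a<..<b} = b - a"
    "measure unif {..b} = b" "measure unif {..<b} = b"
proof -
  interpret prob_space unif by (rule prob_space_unif)
  have single: "measure unif {c} = 0" for c
    by (subst measure_unif) (auto simp: Int_insert_right)
  have half: "measure unif {..<c} = c" if "0 \<le> c" "c \<le> 1" for c
  proof -
    have "{0..<1} \<inter> {..<c} = {0..<c}" using that by auto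
    thus ?thesis using that by (simp add: measure_unif)
  qed
  have closed: "measure unif {..c} = c" if "0 \<le> c" "c \<le> 1" for c
  proof -
    have "{..c} = {..<c} \<union> {c}" by auto
    hence "measure unif {..c} = measure unif {..<c} + measure unif {c}"
      by (simp only:) (rule finite_measure_Union; simp)
    thus ?thesis using half[OF that] single by simp
  qed
  show "measure unif {..b} = b" "measure unif {..<b} = b"
    using half closed assms by auto
  have "measure unif ({..b} - {..<a}) = measure unif {..b} - measure unif {..<a}"
    by (rule finite_measure_Diff) (use assms in auto)
  moreover have "{..b} - {..<a} = {a..b}" by auto
  ultimately show "measure unif {a..b} = b - a" using half closed assms by simp
  show "measure unif {a<..<b} = b - a"
  proof (cases "a = b")
    case False
    hence "measure unif ({..<b} - {..a}) = measure unif {..<b} - measure unif {..a}"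
      using assms by (intro finite_measure_Diff) auto
    moreover have "{..<b} - {..a} = {a<..<b}" by auto
    ultimately show ?thesis using half closed assms by simp
  qed simp
qed

context prob_space
begin

text \<open>Fubini's theorem for independent variables: an event about \<open>(X, Y)\<close> may be evaluated by freezing
  \<open>X\<close> and integrating over its law.\<close>
lemma prob_indep_pair:
  assumes ind: "indep_var S X T Y"
    and R: "{z \<in> space (S \<Otimes>\<^sub>M T). R (fst z) (snd z)} \<in> sets (S \<Otimes>\<^sub>M T)"
  shows "prob {\<omega> \<in> space M. R (X \<omega>) (Y \<omega>)} =
         (\<integral>\<omega>. prob {\<omega>' \<in> space M. R (X \<omega>) (Y \<omega>')} \<partial>M)"
proof -
  let ?A = "{z \<in> space (S \<Otimes>\<^sub>M T). R (fst z) (snd z)}"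
  have X[measurable]: "X \<in> measurable M S" and Y[measurable]: "Y \<in> measurable M T"
    and joint: "distr M S X \<Otimes>\<^sub>M distr M T Y = distr M (S \<Otimes>\<^sub>M T) (\<lambda>x. (X x, Y x))"
    using ind by (auto simp: indep_var_distribution_eq)
  interpret Y: prob_space "distr M T Y" by (rule prob_space_distr[OF Y])
  interpret XY: pair_prob_space "distr M S X" "distr M T Y"
    by (intro pair_prob_space.intro pair_sigma_finite.intro prob_space_imp_sigma_finite
        prob_space_distr X Y)
  have sets_eq: "sets (distr M S X \<Otimes>\<^sub>M distr M T Y) = sets (S \<Otimes>\<^sub>M T)"
    by (intro sets_pair_measure_cong) auto
  have slice: "Pair (X \<omega>) -` ?A \<in> sets T" if "\<omega> \<in> space M" for \<omega>
    using sets_Pair1[OF R] .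
  have slice_eq: "Y -` (Pair (X \<omega>) -` ?A) \<inter> space M = {\<omega>' \<in> space M. R (X \<omega>) (Y \<omega>')}"
    if "\<omega> \<in> space M" for \<omega>
    using that measurable_space[OF X] measurable_space[OF Y] by (auto simp: space_pair_measure)
  have meas: "(\<lambda>x. emeasure (distr M T Y) (Pair x -` ?A)) \<in> borel_measurable S"
    using Y.measurable_emeasure_Pair[of ?A S] R sets_eq
    by (simp cong: sets_pair_measure_cong)
  have eq: "emeasure (distr M T Y) (Pair (X \<omega>) -` ?A) = ennreal (prob {\<omega>' \<in> space M. R (X \<omega>) (Y \<omega>')})"
    if "\<omega> \<in> space M" for \<omega>
    using slice[OF that] slice_eq[OF that] by (simp add: emeasure_distr emeasure_eq_measure)
  have meas': "(\<lambda>\<omega>. prob {\<omega>' \<in> space M. R (X \<omega>) (Y \<omega>')}) \<in> borel_measurable M"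
  proof -
    have "(\<lambda>\<omega>. enn2real (emeasure (distr M T Y) (Pair (X \<omega>) -` ?A))) \<in> borel_measurable M"
      using measurable_compose[OF X meas] by simp
    thus ?thesis by (rule measurable_cong[THEN iffD1, rotated]) (simp only: eq enn2real_ennreal measure_nonneg)
  qed
  have "ennreal (prob {\<omega> \<in> space M. R (X \<omega>) (Y \<omega>)}) =
      emeasure (distr M (S \<Otimes>\<^sub>M T) (\<lambda>x. (X x, Y x))) ?A"
  proof -
    have "(\<lambda>x. (X x, Y x)) -` ?A \<inter> space M = {\<omega> \<in> space M. R (X \<omega>) (Y \<omega>)}"
      using measurable_space[OF X] measurable_space[OF Y] by (auto simp: space_pair_measure)
    thus ?thesis using R by (simp add: emeasure_distr emeasure_eq_measure)
  qed
  also have "\<dots> = emeasure (distr M S X \<Otimes>\<^sub>M distr M T Y) ?A" by (simp add: joint)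
  also have "\<dots> = (\<integral>\<^sup>+x. emeasure (distr M T Y) (Pair x -` ?A) \<partial>distr M S X)"
    by (rule Y.emeasure_pair_measure_alt) (simp add: R sets_eq)
  also have "\<dots> = (\<integral>\<^sup>+\<omega>. emeasure (distr M T Y) (Pair (X \<omega>) -` ?A) \<partial>M)"
    using meas by (intro nn_integral_distr X) simp
  also have "\<dots> = (\<integral>\<^sup>+\<omega>. ennreal (prob {\<omega>' \<in> space M. R (X \<omega>) (Y \<omega>')}) \<partial>M)"
    by (intro nn_integral_cong eq)
  also have "\<dots> = ennreal (\<integral>\<omega>. prob {\<omega>' \<in> space M. R (X \<omega>) (Y \<omega>')} \<partial>M)"
    using meas' by (intro nn_integral_eq_integral integrable_const_bound[where B = 1]) auto
  finally show ?thesis by (simp add: integral_nonneg_AE)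
qed

lemma AE_indep_neq:
  fixes X Y :: "'a \<Rightarrow> real"
  assumes ind: "indep_var borel X borel Y" and Y: "distr M borel Y = unif"
  shows "AE \<omega> in M. X \<omega> \<noteq> Y \<omega>"
proof -
  have [measurable]: "X \<in> borel_measurable M" "Y \<in> borel_measurable M"
    using ind by (auto simp: indep_var_distribution_eq)
  have null: "prob {\<omega> \<in> space M. x = Y \<omega>} = 0" for x
  proof -
    have "prob {\<omega> \<in> space M. x = Y \<omega>} = measure (distr M borel Y) {x}"
      by (auto simp: measure_distr intro!: arg_cong[where f = prob])
    thus ?thesis unfolding Y by (subst (asm) measure_unif) (auto simp: Int_insert_right)
  qed
  have "prob {\<omega> \<in> space M. X \<omega> = Y \<omega>} = (\<integral>\<omega>. prob {\<omega>' \<in> space M. X \<omega> = Y \<omega>'} \<partial>M)"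
    using ind by (rule prob_indep_pair) measurable
  also have "\<dots> = 0" by (simp add: null)
  finally have "prob {\<omega> \<in> space M. X \<omega> = Y \<omega>} = 0" .
  thus ?thesis by (subst AE_iff_measurable[OF _ refl]) (auto simp: emeasure_eq_measure)
qed

text \<open>Write \<open>max 0 (x - X)\<close> as the integral of the indicator of \<open>X \<le> t\<close> over \<open>t \<in> [0,x]\<close> and
  exchange the two integrals.\<close>
lemma expectation_pos_part:
  fixes X :: "'a \<Rightarrow> real"
  assumes X[measurable]: "X \<in> borel_measurable M"
    and X0: "\<And>\<omega>. \<omega> \<in> space M \<Longrightarrow> 0 \<le> X \<omega>"
    and x: "0 \<le> x"
    and F: "\<And>t. 0 \<le> t \<Longrightarrow> t \<le> x \<Longrightarrow> prob {\<omega> \<in> space M. X \<omega> \<le> t} = F t"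
    and F_meas[measurable]: "F \<in> borel_measurable borel"
    and G: "\<And>t. (G has_real_derivative F t) (at t)" "G 0 = 0"
  shows "(\<integral>\<omega>. max 0 (x - X \<omega>) \<partial>M) = G x"
proof -
  interpret P: pair_sigma_finite lborel M
    by (intro pair_sigma_finite.intro prob_space_imp_sigma_finite prob_space_axioms
        lborel.sigma_finite_measure_axioms)
  have F0: "0 \<le> F t" if "0 \<le> t" "t \<le> x" for t using F[OF that] by (metis measure_nonneg)
  have "G 0 \<le> G x" using x
    by (rule DERIV_nonneg_imp_nondecreasing) (use F0 G in blast)
  have inner: "(\<integral>\<^sup>+t. indicator {z. 0 \<le> fst z \<and> fst z \<le> x \<and> X (snd z) \<le> fst z} (t, \<omega>) \<partial>lborel)
      = ennreal (max 0 (x - X \<omega>))" if "\<omega> \<in> space M" for \<omega>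
  proof -
    have "(\<integral>\<^sup>+t. indicator {z. 0 \<le> fst z \<and> fst z \<le> x \<and> X (snd z) \<le> fst z} (t, \<omega>) \<partial>lborel)
       = (\<integral>\<^sup>+t. indicator {X \<omega>..x} t \<partial>lborel)"
      using X0[OF that] by (intro nn_integral_cong) (auto simp: indicator_def)
    also have "\<dots> = ennreal (max 0 (x - X \<omega>))"
      by (cases "X \<omega> \<le> x") (auto simp: max_def)
    finally show ?thesis .
  qed
  have "(\<integral>\<^sup>+\<omega>. ennreal (max 0 (x - X \<omega>)) \<partial>M) =
      (\<integral>\<^sup>+\<omega>. \<integral>\<^sup>+t. indicator {z. 0 \<le> fst z \<and> fst z \<le> x \<and> X (snd z) \<le> fst z} (t, \<omega>) \<partial>lborel \<partial>M)"
    by (intro nn_integral_cong inner[symmetric])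
  also have "\<dots> = (\<integral>\<^sup>+t. \<integral>\<^sup>+\<omega>. indicator {z. 0 \<le> fst z \<and> fst z \<le> x \<and> X (snd z) \<le> fst z} (t, \<omega>) \<partial>M \<partial>lborel)"
  proof (rule P.Fubini)
    have "{z \<in> space (lborel \<Otimes>\<^sub>M M). 0 \<le> fst z \<and> fst z \<le> x \<and> X (snd z) \<le> fst z} \<in> sets (lborel \<Otimes>\<^sub>M M)"
      by measurable
    hence "(\<lambda>z. indicator {z \<in> space (lborel \<Otimes>\<^sub>M M). 0 \<le> fst z \<and> fst z \<le> x \<and> X (snd z) \<le> fst z} z :: ennreal)
        \<in> borel_measurable (lborel \<Otimes>\<^sub>M M)" by (rule borel_measurable_indicator)
    thus "(\<lambda>z. indicator {z. 0 \<le> fst z \<and> fst z \<le> x \<and> X (snd z) \<le> fst z} z :: ennreal)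
        \<in> borel_measurable (lborel \<Otimes>\<^sub>M M)"
      by (rule measurable_cong[THEN iffD1, rotated]) (auto simp: indicator_def)
  qed
  also have "\<dots> = (\<integral>\<^sup>+t. ennreal (F t) * indicator {0..x} t \<partial>lborel)"
  proof (intro nn_integral_cong)
    fix t :: real
    have "(\<integral>\<^sup>+\<omega>. indicator {z. 0 \<le> fst z \<and> fst z \<le> x \<and> X (snd z) \<le> fst z} (t, \<omega>) \<partial>M)
      = (\<integral>\<^sup>+\<omega>. indicator {0..x} t * indicator {\<omega> \<in> space M. X \<omega> \<le> t} \<omega> \<partial>M)"
      by (intro nn_integral_cong) (auto simp: indicator_def)
    also have "\<dots> = indicator {0..x} t * emeasure M {\<omega> \<in> space M. X \<omega> \<le> t}"
      by (subst nn_integral_cmult) auto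
    also have "\<dots> = ennreal (F t) * indicator {0..x} t"
      using F by (auto simp: indicator_def emeasure_eq_measure)
    finally show "(\<integral>\<^sup>+\<omega>. indicator {z. 0 \<le> fst z \<and> fst z \<le> x \<and> X (snd z) \<le> fst z} (t, \<omega>) \<partial>M)
      = ennreal (F t) * indicator {0..x} t" .
  qed
  also have "\<dots> = ennreal (G x - G 0)"
    by (rule nn_integral_FTC_Icc) (use x F0 G in \<open>auto intro: has_field_derivative_at_within simp: has_real_derivative_iff_has_vector_derivative[symmetric]\<close>)
  finally have "(\<integral>\<^sup>+\<omega>. ennreal (max 0 (x - X \<omega>)) \<partial>M) = ennreal (G x)" using G(2) by simp
  moreover have "0 \<le> G x" using \<open>G 0 \<le> G x\<close> G(2) by simp
  ultimately show ?thesis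
    by (intro integral_eq_nn_integral[THEN trans]) auto
qed

end

lemma borel_measurable_clock_pos:
  assumes "\<And>i. i \<in> {1..k} \<Longrightarrow> u i \<in> borel_measurable N"
    "\<And>i. i \<in> {1..k} \<Longrightarrow> v i \<in> borel_measurable N"
  shows "(\<lambda>\<omega>. clock_pos (\<lambda>i. u i \<omega>) (\<lambda>i. v i \<omega>) k) \<in> borel_measurable N"
  using assms
proof (induction k)
  case (Suc k)
  have [measurable]: "(\<lambda>\<omega>. clock_pos (\<lambda>i. u i \<omega>) (\<lambda>i. v i \<omega>) k) \<in> borel_measurable N"
    by (rule Suc.IH) (use Suc.prems in auto)
  have [measurable]: "u (Suc k) \<in> borel_measurable N" "v (Suc k) \<in> borel_measurable N"
    using Suc.prems by auto
  show ?case unfolding clock_pos.simps frac_def by measurable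
qed simp

lemma clock_pos_cong:
  assumes "\<And>i. i \<in> {1..k} \<Longrightarrow> u i = u' i" "\<And>i. i \<in> {1..k} \<Longrightarrow> v i = v' i"
  shows "clock_pos u v k = clock_pos u' v' k"
  using assms by (induction k) auto

lemma clock_pos_range:
  assumes "\<And>i. i \<in> {1..k} \<Longrightarrow> u i \<in> {0..<1}" "\<And>i. i \<in> {1..k} \<Longrightarrow> v i \<in> {0..<1}"
  shows "clock_pos u v k \<in> {0..<1}"
  using assms by (cases k) auto

abbreviation count_le :: "'i set \<Rightarrow> real \<Rightarrow> ('i \<Rightarrow> real) \<Rightarrow> nat" where
  "count_le L x w \<equiv> card {j \<in> L. w j \<le> x}"

lemma count_le_measurable:
  assumes L: "finite L"
  shows "{w \<in> space (Pi\<^sub>M L (\<lambda>_. unif)). count_le L x w = m} \<in> sets (Pi\<^sub>M L (\<lambda>_. unif))"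
proof -
  have [measurable]: "(\<lambda>w. w j) \<in> borel_measurable (Pi\<^sub>M L (\<lambda>_. unif))" if "j \<in> L" for j
    using measurable_component_singleton[OF that, of "\<lambda>_. unif"]
      measurable_cong_sets[of "Pi\<^sub>M L (\<lambda>_. unif)" "Pi\<^sub>M L (\<lambda>_. unif)" unif borel] by simp
  have "{w \<in> space (Pi\<^sub>M L (\<lambda>_. unif)). count_le L x w = m} =
     {w \<in> space (Pi\<^sub>M L (\<lambda>_. unif)). (\<Sum>j\<in>L. if w j \<le> x then 1 else 0 :: nat) = m}"
    by (simp flip: sum.inter_filter[OF L])
  also have "\<dots> \<in> sets (Pi\<^sub>M L (\<lambda>_. unif))" using L by measurable
  finally show ?thesis .
qed

text \<open>The number of points up to \<open>x\<close> is binomially distributed.\<close>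
lemma measure_count_le:
  assumes L: "finite L" and x: "0 \<le> x" "x \<le> 1"
  shows "measure (Pi\<^sub>M L (\<lambda>_. unif)) {w \<in> space (Pi\<^sub>M L (\<lambda>_. unif)). count_le L x w = m} =
         real (card L choose m) * x ^ m * (1 - x) ^ (card L - m)"
proof -
  interpret u: prob_space unif by (rule prob_space_unif)
  interpret finite_product_prob_space "\<lambda>_. unif" L
    by unfold_locales (use L in auto)
  let ?I = "\<lambda>S j. if j \<in> S then {..x} else {x<..}"
  have "{w \<in> space (Pi\<^sub>M L (\<lambda>_. unif)). count_le L x w = m} = (\<Union>S\<in>{S. S \<subseteq> L \<and> card S = m}. Pi\<^sub>E L (?I S))"
  proof (rule set_eqI)
    fix w
    have "w \<in> Pi\<^sub>E L (?I S) \<longleftrightarrow> w \<in> space (Pi\<^sub>M L (\<lambda>_. unif)) \<and> S = {j \<in> L. w j \<le> x}" if "S \<subseteq> L" for S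
      using that by (auto simp: space_PiM PiE_iff split: if_splits)
    thus "w \<in> {w \<in> space (Pi\<^sub>M L (\<lambda>_. unif)). count_le L x w = m} \<longleftrightarrow>
        w \<in> (\<Union>S\<in>{S. S \<subseteq> L \<and> card S = m}. Pi\<^sub>E L (?I S))" by auto
  qed
  also have "measure (Pi\<^sub>M L (\<lambda>_. unif)) \<dots> = (\<Sum>S\<in>{S. S \<subseteq> L \<and> card S = m}. measure (Pi\<^sub>M L (\<lambda>_. unif)) (Pi\<^sub>E L (?I S)))"
  proof (rule finite_measure_finite_Union)
    show "finite {S. S \<subseteq> L \<and> card S = m}"
      by (rule finite_subset[of _ "Pow L"]) (use L in auto)
    show "(\<lambda>S. Pi\<^sub>E L (?I S)) ` {S. S \<subseteq> L \<and> card S = m} \<subseteq> sets (Pi\<^sub>M L (\<lambda>_. unif))"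
      by (auto intro!: sets_PiM_I_finite L)
    show "disjoint_family_on (\<lambda>S. Pi\<^sub>E L (?I S)) {S. S \<subseteq> L \<and> card S = m}"
      unfolding disjoint_family_on_def
    proof (intro ballI impI)
      fix S T assume *: "S \<in> {S. S \<subseteq> L \<and> card S = m}" "T \<in> {S. S \<subseteq> L \<and> card S = m}" "S \<noteq> T"
      have det: "S = {j \<in> L. w j \<le> x}" if "w \<in> Pi\<^sub>E L (?I S)" "S \<subseteq> L" for w S
        using that by (auto simp: PiE_iff split: if_splits)
      have "S = T" if "w \<in> Pi\<^sub>E L (?I S)" "w \<in> Pi\<^sub>E L (?I T)" for w
        using det[OF that(1)] det[OF that(2)] *(1,2) by simp
      thus "Pi\<^sub>E L (?I S) \<inter> Pi\<^sub>E L (?I T) = {}" using *(3) by blast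
    qed
  qed
  also have "\<dots> = (\<Sum>S\<in>{S. S \<subseteq> L \<and> card S = m}. x ^ m * (1 - x) ^ (card L - m))"
  proof (intro sum.cong refl)
    fix S assume S: "S \<in> {S. S \<subseteq> L \<and> card S = m}"
    have le: "measure unif {..x} = x" using measure_unif_ivl(3)[of 0 x] x by simp
    have gt: "measure unif {x<..} = 1 - x"
    proof -
      have "{x<..} = space unif - {..x}" by auto
      thus ?thesis using u.prob_compl[of "{..x}"] le by simp
    qed
    have "measure (Pi\<^sub>M L (\<lambda>_. unif)) (Pi\<^sub>E L (?I S)) = (\<Prod>j\<in>L. measure unif (?I S j))"
      by (rule finite_measure_PiM_emb) auto
    also have "\<dots> = (\<Prod>j\<in>L. if j \<in> S then x else 1 - x)"
      using le gt by (intro prod.cong refl) auto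
    also have "\<dots> = (\<Prod>j\<in>L \<inter> S. x) * (\<Prod>j\<in>L - S. 1 - x)"
      by (subst prod.If_cases) (auto simp: Diff_eq L)
    also have "\<dots> = x ^ m * (1 - x) ^ (card L - m)"
    proof -
      have "L \<inter> S = S" using S by auto
      moreover have "card (L - S) = card L - m"
        using S L by (subst card_Diff_subset) (auto intro: finite_subset)
      ultimately show ?thesis using S by simp
    qed
    finally show "measure (Pi\<^sub>M L (\<lambda>_. unif)) (Pi\<^sub>E L (?I S)) = x ^ m * (1 - x) ^ (card L - m)" .
  qed
  also have "\<dots> = real (card L choose m) * x ^ m * (1 - x) ^ (card L - m)"
    using n_subsets[OF L, of m] by simp
  finally show ?thesis .
qed

lemma count_le_permute:
  assumes "\<pi> permutes L"
  shows "count_le L x (\<lambda>i\<in>L. w (\<pi> i)) = count_le L x w"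
proof -
  have "{j \<in> L. w j \<le> x} = \<pi> ` {i \<in> L. w (\<pi> i) \<le> x}"
  proof (intro equalityI subsetI)
    fix j assume j: "j \<in> {j \<in> L. w j \<le> x}"
    obtain i where "i \<in> L" "j = \<pi> i" using permutes_image[OF assms] j by blast
    thus "j \<in> \<pi> ` {i \<in> L. w (\<pi> i) \<le> x}" using j by blast
  next
    fix j assume "j \<in> \<pi> ` {i \<in> L. w (\<pi> i) \<le> x}"
    thus "j \<in> {j \<in> L. w j \<le> x}" using permutes_in_image[OF assms] by blast
  qed
  hence "count_le L x w = card {i \<in> L. w (\<pi> i) \<le> x}"
    using card_image[OF permutes_inj_on[OF assms]] by simp
  moreover have "{i \<in> L. (\<lambda>i\<in>L. w (\<pi> i)) i \<le> x} = {i \<in> L. w (\<pi> i) \<le> x}" by auto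
  ultimately show ?thesis by simp
qed

text \<open>For \<open>y \<le> x\<close> the first point met lies in \<open>[0,x]\<close> if some point lies in \<open>[y,x]\<close>, or
  if both lie in \<open>[0,y)\<close>; for \<open>x < y\<close> it does so if both points lie below \<open>y\<close> but not
  both beyond \<open>x\<close>.  Both conditions combine events of the form that two points lie in the same set,
  whose probabilities are squares.\<close>
lemma first_met_le_iff:
  fixes y a b x :: real
  assumes y: "y \<in> {0..<1}" and a: "a \<in> {0..<1}" and b: "b \<in> {0..<1}"
  shows "y \<le> x \<Longrightarrow> (if frac (a - y) \<le> frac (b - y) then a else b) \<le> x \<longleftrightarrow>
           \<not> (a \<in> - {y..x} \<and> b \<in> - {y..x}) \<or> (a \<in> {..<y} \<and> b \<in> {..<y})"
    and "x < y \<Longrightarrow> (if frac (a - y) \<le> frac (b - y) then a else b) \<le> x \<longleftrightarrow>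
           (a \<in> {..<y} \<and> b \<in> {..<y}) \<and> \<not> (a \<in> {x<..<y} \<and> b \<in> {x<..<y})"
  unfolding frac_le_iff_clockwise_le[OF y a b] clockwise_le_def
  by (auto split: if_splits)

lemma first_met_measurable:
  fixes f g h :: "'b \<Rightarrow> real"
  assumes [measurable]: "f \<in> borel_measurable N" "g \<in> borel_measurable N" "h \<in> borel_measurable N"
  shows "{p \<in> space N. (if frac (g p - f p) \<le> frac (h p - f p) then g p else h p) \<le> x} \<in> sets N"
  unfolding frac_def by measurable

section \<open>The law of the final position and of the final index\<close>

text \<open>The probabilistic setting: \<open>n\<close> pairs of independent uniform points in \<open>[0,1)\<close>.\<close>
locale clock_pairs = prob_space M for M :: "'a measure" +
  fixes U U' :: "nat \<Rightarrow> 'a \<Rightarrow> real" and n :: nat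
  assumes n: "n \<ge> 1"
    and range: "\<And>i \<omega>. i \<in> {1..n} \<Longrightarrow> \<omega> \<in> space M \<Longrightarrow> U i \<omega> \<in> {0..<1} \<and> U' i \<omega> \<in> {0..<1}"
    and indep: "indep_vars (\<lambda>_. borel) (\<lambda>(i, b). if b then U' i else U i) (clock_labels n)"
    and distr_U: "\<And>i. i \<in> {1..n} \<Longrightarrow> distr M borel (U i) = unif"
    and distr_U': "\<And>i. i \<in> {1..n} \<Longrightarrow> distr M borel (U' i) = unif"
begin

text \<open>All the points as a single family, the position of the clock, and the law of the family.\<close>
abbreviation W :: "nat \<times> bool \<Rightarrow> 'a \<Rightarrow> real" where
  "W \<equiv> (\<lambda>(i, b). if b then U' i else U i)"

abbreviation pos :: "nat \<Rightarrow> 'a \<Rightarrow> real" where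
  "pos k \<omega> \<equiv> clock_pos (\<lambda>i. U i \<omega>) (\<lambda>i. U' i \<omega>) k"

abbreviation \<Omega> :: "(nat \<times> bool \<Rightarrow> real) measure" where
  "\<Omega> \<equiv> Pi\<^sub>M (clock_labels n) (\<lambda>_. unif)"

lemma W_measurable: "j \<in> clock_labels n \<Longrightarrow> W j \<in> borel_measurable M"
  using indep unfolding indep_vars_def by blast

lemma U_measurable:
  assumes "i \<in> {1..n}" shows "U i \<in> borel_measurable M" "U' i \<in> borel_measurable M"
  using W_measurable[of "(i, False)"] W_measurable[of "(i, True)"] assms by auto

lemma distr_W: "j \<in> clock_labels n \<Longrightarrow> distr M borel (W j) = unif"
  using distr_U distr_U' by auto

lemma W_range: "j \<in> clock_labels n \<Longrightarrow> \<omega> \<in> space M \<Longrightarrow> W j \<omega> \<in> {0..<1}"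
  using range by auto

lemma pos_measurable: "k \<le> n \<Longrightarrow> pos k \<in> borel_measurable M"
  by (rule borel_measurable_clock_pos) (auto intro: U_measurable)

lemma pos_range: "k \<le> n \<Longrightarrow> \<omega> \<in> space M \<Longrightarrow> pos k \<omega> \<in> {0..<1}"
  by (rule clock_pos_range) (use range in auto)

lemma prob_pair_both:
  assumes i: "i \<in> {1..n}" and A: "A \<in> sets borel"
  shows "prob {\<omega> \<in> space M. U i \<omega> \<in> A \<and> U' i \<omega> \<in> A} = (measure unif A)\<^sup>2"
proof -
  have sub: "{(i, False), (i, True)} \<subseteq> clock_labels n" using i by auto
  have single: "prob (W j -` A \<inter> space M) = measure unif A" if "j \<in> clock_labels n" for j
    using measure_distr[OF W_measurable[OF that] A] distr_W[OF that] by simp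
  have "{\<omega> \<in> space M. U i \<omega> \<in> A \<and> U' i \<omega> \<in> A} = (\<Inter>j\<in>{(i, False), (i, True)}. W j -` A \<inter> space M)"
    by auto
  also have "prob \<dots> = (\<Prod>j\<in>{(i, False), (i, True)}. prob (W j -` A \<inter> space M))"
    by (rule indep_varsD_finite[OF indep_vars_subset[OF indep sub]]) (use A in auto)
  also have "\<dots> = (\<Prod>j\<in>{(i, False), (i, True)}. measure unif A)"
    using sub by (intro prod.cong refl single) auto
  also have "\<dots> = (measure unif A)\<^sup>2" by (simp add: power2_eq_square)
  finally show ?thesis .
qed

lemma prob_first_met_le:
  assumes i: "i \<in> {1..n}" and y: "y \<in> {0..<1}" and x: "0 \<le> x" "x \<le> 1"
  shows "prob {\<omega> \<in> space M.
           (if frac (U i \<omega> - y) \<le> frac (U' i \<omega> - y) then U i \<omega> else U' i \<omega>) \<le> x} =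
         2 * x * y - x\<^sup>2 + 2 * max 0 (x - y)" (is "prob ?E = _")
proof -
  note [measurable] = U_measurable[OF i]
  interpret u: prob_space unif by (rule prob_space_unif)
  let ?both = "\<lambda>A. {\<omega> \<in> space M. U i \<omega> \<in> A \<and> U' i \<omega> \<in> A}"
  have both_sets: "?both A \<in> sets M" if "A \<in> sets borel" for A
    using that by measurable
  show ?thesis
  proof (cases "y \<le> x")
    case True
    have split: "?E = (space M - ?both (- {y..x})) \<union> ?both {..<y}"
    proof (rule set_eqI)
      fix \<omega>
      show "\<omega> \<in> ?E \<longleftrightarrow> \<omega> \<in> (space M - ?both (- {y..x})) \<union> ?both {..<y}"
      proof (cases "\<omega> \<in> space M")
        case in_space: True
        have "U i \<omega> \<in> {0..<1}" "U' i \<omega> \<in> {0..<1}" using range[OF i in_space] by simp_all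
        note iff = first_met_le_iff(1)[OF y this True]
        show ?thesis using in_space by (simp only: mem_Collect_eq Un_iff Diff_iff iff) blast
      qed simp
    qed
    have "prob ?E = prob (space M - ?both (- {y..x})) + prob (?both {..<y})"
      unfolding split
    proof (rule finite_measure_Union)
      show "space M - ?both (- {y..x}) \<in> sets M" "?both {..<y} \<in> sets M"
        by (intro sets.compl_sets both_sets borel_comp borel_closed closed_atLeastAtMost
            borel_open open_lessThan)+
      show "(space M - ?both (- {y..x})) \<inter> ?both {..<y} = {}" by fastforce
    qed
    also have "\<dots> = 1 - (1 - (x - y))\<^sup>2 + y\<^sup>2"
    proof -
      have "measure unif (- {y..x}) = 1 - (x - y)"
      proof -
        have "measure unif (space unif - {y..x}) = 1 - measure unif {y..x}"
          by (rule u.prob_compl) simp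
        moreover have "measure unif {y..x} = x - y"
          using True x y by (intro measure_unif_ivl) simp_all
        moreover have "space unif - {y..x} = - {y..x}" by (simp add: Compl_eq_Diff_UNIV[symmetric])
        ultimately show ?thesis by (simp only:)
      qed
      moreover have "measure unif {..<y} = y"
        using measure_unif_ivl(4)[of 0 y] y by auto
      ultimately show ?thesis
        by (subst prob_compl[OF both_sets]) (simp_all only: prob_pair_both[OF i] borel_comp borel_closed
            closed_atLeastAtMost borel_open open_lessThan)
    qed
    also have "\<dots> = 2 * x * y - x\<^sup>2 + 2 * max 0 (x - y)"
      using True by (simp add: max_def power2_eq_square algebra_simps)
    finally show ?thesis .
  next
    case False
    have split: "?E = ?both {..<y} - ?both {x<..<y}"
    proof (rule set_eqI)
      fix \<omega>
      show "\<omega> \<in> ?E \<longleftrightarrow> \<omega> \<in> ?both {..<y} - ?both {x<..<y}"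
      proof (cases "\<omega> \<in> space M")
        case in_space: True
        have "U i \<omega> \<in> {0..<1}" "U' i \<omega> \<in> {0..<1}" using range[OF i in_space] by simp_all
        moreover have "x < y" using False by simp
        ultimately have iff: "(if frac (U i \<omega> - y) \<le> frac (U' i \<omega> - y) then U i \<omega> else U' i \<omega>) \<le> x \<longleftrightarrow>
            (U i \<omega> \<in> {..<y} \<and> U' i \<omega> \<in> {..<y}) \<and> \<not> (U i \<omega> \<in> {x<..<y} \<and> U' i \<omega> \<in> {x<..<y})"
          by (rule first_met_le_iff(2)[OF y])
        show ?thesis using in_space by (simp only: mem_Collect_eq Diff_iff iff) blast
      qed simp
    qed
    have "prob ?E = prob (?both {..<y}) - prob (?both {x<..<y})"
      unfolding split
    proof (rule finite_measure_Diff)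
      show "?both {..<y} \<in> sets M" "?both {x<..<y} \<in> sets M"
        by (intro both_sets borel_open open_lessThan open_greaterThanLessThan)+
      show "?both {x<..<y} \<subseteq> ?both {..<y}" by fastforce
    qed
    also have "\<dots> = y\<^sup>2 - (y - x)\<^sup>2"
    proof -
      have "measure unif {x<..<y} = y - x" using measure_unif_ivl(2)[of x y] False x y by auto
      moreover have "measure unif {..<y} = y"
        using measure_unif_ivl(4)[of 0 y] y by auto
      ultimately show ?thesis
        using prob_pair_both[OF i, of "{x<..<y}"] prob_pair_both[OF i, of "{..<y}"] by simp
    qed
    also have "\<dots> = 2 * x * y - x\<^sup>2 + 2 * max 0 (x - y)"
      using False by (simp add: max_def power2_eq_square algebra_simps)
    finally show ?thesis .
  qed
qed

text \<open>The position after \<open>k\<close> steps is a function of the first \<open>k\<close> pairs and therefore independent of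
  the next pair.\<close>
lemma prob_pos_Suc_le:
  assumes k: "Suc k \<le> n" and x: "0 \<le> x" "x \<le> 1"
  shows "prob {\<omega> \<in> space M. pos (Suc k) \<omega> \<le> x} =
     2 * x * (1 - (\<integral>\<omega>. max 0 (1 - pos k \<omega>) \<partial>M)) - x\<^sup>2 + 2 * (\<integral>\<omega>. max 0 (x - pos k \<omega>) \<partial>M)"
proof -
  have i: "Suc k \<in> {1..n}" using k by auto
  have kn: "k \<le> n" using k by simp
  have X[measurable]: "pos k \<in> borel_measurable M" by (rule pos_measurable[OF kn])
  let ?A = "{1..k} \<times> (UNIV :: bool set)" and ?B = "{Suc k} \<times> (UNIV :: bool set)"
  let ?W = "\<lambda>J \<omega>. \<lambda>j\<in>J. W j \<omega>"
  define start :: "(nat \<times> bool \<Rightarrow> real) \<Rightarrow> real" where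
    "start w = clock_pos (\<lambda>i. w (i, False)) (\<lambda>i. w (i, True)) k" for w
  define R :: "(nat \<times> bool \<Rightarrow> real) \<Rightarrow> (nat \<times> bool \<Rightarrow> real) \<Rightarrow> bool" where
    "R w z \<longleftrightarrow> (if frac (z (Suc k, False) - start w) \<le> frac (z (Suc k, True) - start w)
       then z (Suc k, False) else z (Suc k, True)) \<le> x" for w z
  have start: "start (?W ?A \<omega>) = pos k \<omega>" for \<omega>
    unfolding start_def by (rule clock_pos_cong) auto
  have R: "R (?W ?A \<omega>) (?W ?B \<omega>') \<longleftrightarrow>
      (if frac (U (Suc k) \<omega>' - pos k \<omega>) \<le> frac (U' (Suc k) \<omega>' - pos k \<omega>)
       then U (Suc k) \<omega>' else U' (Suc k) \<omega>') \<le> x" for \<omega> \<omega>'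
    unfolding R_def start by simp
  have bounds: "0 \<le> pos k \<omega>" "pos k \<omega> \<le> 1" if "\<omega> \<in> space M" for \<omega>
    using pos_range[OF kn that] by auto
  have int_X: "integrable M (pos k)"
    by (rule integrable_const_bound[where B = 1], rule AE_I2) (use bounds X in auto)
  have int_max: "integrable M (\<lambda>\<omega>. max 0 (c - pos k \<omega>))" if "0 \<le> c" "c \<le> 1" for c
  proof (rule integrable_const_bound[where B = 1], rule AE_I2)
    fix \<omega> assume "\<omega> \<in> space M"
    thus "norm (max 0 (c - pos k \<omega>)) \<le> 1" using bounds[of \<omega>] that by simp
  qed (use X in measurable)
  \<comment> \<open>positions stay below 1, so the mean is determined by the positive part at 1\<close>
  have mean: "(\<integral>\<omega>. pos k \<omega> \<partial>M) = 1 - (\<integral>\<omega>. max 0 (1 - pos k \<omega>) \<partial>M)"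
  proof -
    have "(\<integral>\<omega>. max 0 (1 - pos k \<omega>) \<partial>M) = (\<integral>\<omega>. 1 - pos k \<omega> \<partial>M)"
      by (intro Bochner_Integration.integral_cong refl) (use bounds(2) in \<open>simp add: max_def\<close>)
    also have "\<dots> = 1 - (\<integral>\<omega>. pos k \<omega> \<partial>M)"
      using int_X by (simp add: prob_space)
    finally show ?thesis by simp
  qed
  have "prob {\<omega> \<in> space M. pos (Suc k) \<omega> \<le> x} = prob {\<omega> \<in> space M. R (?W ?A \<omega>) (?W ?B \<omega>)}"
    unfolding R by simp
  also have "\<dots> = (\<integral>\<omega>. prob {\<omega>' \<in> space M. R (?W ?A \<omega>) (?W ?B \<omega>')} \<partial>M)"
  proof (rule prob_indep_pair[where X = "?W ?A" and Y = "?W ?B" and R = R])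
    show "indep_var (Pi\<^sub>M ?A (\<lambda>_. borel)) (?W ?A) (Pi\<^sub>M ?B (\<lambda>_. borel)) (?W ?B)"
      by (rule indep_var_restrict[OF indep]) (use k in auto)
    have start_meas: "start \<in> borel_measurable (Pi\<^sub>M ?A (\<lambda>_. borel))"
      unfolding start_def by (rule borel_measurable_clock_pos) (auto intro!: measurable_component_singleton)
    have pair_meas: "(\<lambda>z. z (Suc k, b)) \<in> borel_measurable (Pi\<^sub>M ?B (\<lambda>_. borel))" for b
      by (rule measurable_component_singleton) simp
    show "{p \<in> space (Pi\<^sub>M ?A (\<lambda>_. borel) \<Otimes>\<^sub>M Pi\<^sub>M ?B (\<lambda>_. borel)). R (fst p) (snd p)}
        \<in> sets (Pi\<^sub>M ?A (\<lambda>_. borel) \<Otimes>\<^sub>M Pi\<^sub>M ?B (\<lambda>_. borel))"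
      unfolding R_def
      by (rule first_met_measurable)
         (rule measurable_compose[OF measurable_fst start_meas] measurable_compose[OF measurable_snd pair_meas])+
  qed
  also have "\<dots> = (\<integral>\<omega>. 2 * x * pos k \<omega> - x\<^sup>2 + 2 * max 0 (x - pos k \<omega>) \<partial>M)"
    unfolding R
    by (intro Bochner_Integration.integral_cong refl prob_first_met_le[OF i pos_range[OF kn] x])
  also have "\<dots> = 2 * x * (\<integral>\<omega>. pos k \<omega> \<partial>M) - x\<^sup>2 + 2 * (\<integral>\<omega>. max 0 (x - pos k \<omega>) \<partial>M)"
    using int_X int_max[OF x] by (simp add: prob_space)
  finally show ?thesis unfolding mean .
qed

lemma prob_pos_le:
  assumes "1 \<le> k" "k \<le> n" "0 \<le> x" "x \<le> 1"
  shows "prob {\<omega> \<in> space M. pos k \<omega> \<le> x} = clock_cdf k x"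
  using assms
proof (induction k arbitrary: x)
  case (Suc k)
  show ?case
  proof (cases "k = 0")
    \<comment> \<open>the start is a point mass at 0, which \<open>clock_cdf 0\<close> does not describe\<close>
    case True
    thus ?thesis
      using prob_pos_Suc_le[OF Suc.prems(2-4)] Suc.prems by (simp add: clock_cdf_1 prob_space)
  next
    case False
    have "(\<integral>\<omega>. max 0 (c - pos k \<omega>) \<partial>M) = clock_cdf_integral k c" if c: "0 \<le> c" "c \<le> 1" for c
    proof (rule expectation_pos_part[OF pos_measurable])
      show "clock_cdf k \<in> borel_measurable borel"
        unfolding clock_cdf_def bern_fn_def by measurable
      show "prob {\<omega> \<in> space M. pos k \<omega> \<le> t} = clock_cdf k t" if "0 \<le> t" "t \<le> c" for t
        using Suc.IH[of t] that c False Suc.prems by simp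
    qed (use Suc.prems c pos_range[of k] clock_cdf_integral_has_derivative clock_cdf_integral_0 in auto)
    thus ?thesis
      using prob_pos_Suc_le[OF Suc.prems(2-4)] Suc.prems by (simp add: clock_cdf_Suc del: clock_pos.simps)
  qed
qed simp

lemma distr_W_PiM:
  "distr M (Pi\<^sub>M (clock_labels n) (\<lambda>_. borel)) (\<lambda>\<omega>. \<lambda>j\<in>clock_labels n. W j \<omega>) = \<Omega>"
proof -
  have "clock_labels n \<noteq> {}" using n by auto
  hence "distr M (Pi\<^sub>M (clock_labels n) (\<lambda>_. borel)) (\<lambda>\<omega>. \<lambda>j\<in>clock_labels n. W j \<omega>) =
      Pi\<^sub>M (clock_labels n) (\<lambda>j. distr M borel (W j))"
    using indep_vars_iff_distr_eq_PiM'[where I = "clock_labels n" and M' = "\<lambda>_. borel" and X = W]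
      W_measurable indep by blast
  also have "\<dots> = \<Omega>" using distr_W by (intro PiM_cong refl)
  finally show ?thesis .
qed

lemma W_PiM_measurable:
  "(\<lambda>\<omega>. \<lambda>j\<in>clock_labels n. W j \<omega>) \<in> measurable M (Pi\<^sub>M (clock_labels n) (\<lambda>_. borel))"
  by (intro measurable_restrict W_measurable)

lemma sets_\<Omega>: "sets \<Omega> = sets (Pi\<^sub>M (clock_labels n) (\<lambda>_. borel))"
  by (intro sets_PiM_cong refl) simp

lemma space_\<Omega>: "space \<Omega> = space (Pi\<^sub>M (clock_labels n) (\<lambda>_. borel))"
  by (rule sets_eq_imp_space_eq[OF sets_\<Omega>])

lemma prob_transfer:
  assumes R: "{w \<in> space \<Omega>. R w} \<in> sets \<Omega>"
  shows "measure \<Omega> {w \<in> space \<Omega>. R w} = prob {\<omega> \<in> space M. R (\<lambda>j\<in>clock_labels n. W j \<omega>)}"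
proof -
  have "measure \<Omega> {w \<in> space \<Omega>. R w} =
      measure (distr M (Pi\<^sub>M (clock_labels n) (\<lambda>_. borel)) (\<lambda>\<omega>. \<lambda>j\<in>clock_labels n. W j \<omega>)) {w \<in> space \<Omega>. R w}"
    by (simp only: distr_W_PiM)
  also have "\<dots> = prob ((\<lambda>\<omega>. \<lambda>j\<in>clock_labels n. W j \<omega>) -` {w \<in> space \<Omega>. R w} \<inter> space M)"
    using R unfolding sets_\<Omega> by (rule measure_distr[OF W_PiM_measurable])
  also have "(\<lambda>\<omega>. \<lambda>j\<in>clock_labels n. W j \<omega>) -` {w \<in> space \<Omega>. R w} \<inter> space M =
      {\<omega> \<in> space M. R (\<lambda>j\<in>clock_labels n. W j \<omega>)}"
    using measurable_space[OF W_PiM_measurable] unfolding space_\<Omega> by auto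
  finally show ?thesis .
qed

lemma AE_inj_on: "AE w in \<Omega>. inj_on w (clock_labels n)"
proof -
  let ?L = "clock_labels n"
  have neq: "AE \<omega> in M. W i \<omega> \<noteq> W j \<omega>" if ij: "i \<in> ?L" "j \<in> ?L" "i \<noteq> j" for i j
  proof -
    have "indep_var (Pi\<^sub>M {i} (\<lambda>_. borel)) (\<lambda>\<omega>. restrict (\<lambda>j. W j \<omega>) {i})
          (Pi\<^sub>M {j} (\<lambda>_. borel)) (\<lambda>\<omega>. restrict (\<lambda>j. W j \<omega>) {j})"
      by (rule indep_var_restrict[OF indep]) (use ij in auto)
    hence "indep_var borel ((\<lambda>w. w i) \<circ> (\<lambda>\<omega>. restrict (\<lambda>j. W j \<omega>) {i}))
          borel ((\<lambda>w. w j) \<circ> (\<lambda>\<omega>. restrict (\<lambda>j. W j \<omega>) {j}))"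
      by (rule indep_var_compose) (auto intro!: measurable_component_singleton)
    hence "indep_var borel (W i) borel (W j)" by (simp add: o_def)
    thus ?thesis using distr_W[OF ij(2)] by (rule AE_indep_neq)
  qed
  have "AE \<omega> in M. \<forall>i\<in>?L. \<forall>j\<in>?L. i \<noteq> j \<longrightarrow> W i \<omega> \<noteq> W j \<omega>"
    using neq by (intro AE_finite_allI) auto
  hence "AE \<omega> in M. inj_on (\<lambda>j\<in>?L. W j \<omega>) ?L"
  proof eventually_elim
    case (elim \<omega>)
    show ?case
    proof (rule inj_onI, rule ccontr)
      fix i j
      assume *: "i \<in> ?L" "j \<in> ?L" "(\<lambda>j\<in>?L. W j \<omega>) i = (\<lambda>j\<in>?L. W j \<omega>) j" "i \<noteq> j"
      hence "W i \<omega> = W j \<omega>" by (simp only: restrict_apply if_True)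
      with mp[OF bspec[OF bspec[OF elim *(1)] *(2)] *(4)] show False by (rule notE)
    qed
  qed
  moreover have "{w \<in> space (Pi\<^sub>M ?L (\<lambda>_. borel :: real measure)). inj_on w ?L} \<in> sets (Pi\<^sub>M ?L (\<lambda>_. borel))"
  proof (rule order_pattern_measurable)
    have "inj_on w ?L \<longleftrightarrow> (\<forall>i\<in>?L. \<forall>j\<in>?L. i \<noteq> j \<longrightarrow>
        (i, j) \<in> order_pattern ?L w \<or> (j, i) \<in> order_pattern ?L w)" for w :: "nat \<times> bool \<Rightarrow> real"
      unfolding inj_on_def order_pattern_iff using linorder_neq_iff by metis
    thus "inj_on w ?L = inj_on w' ?L" if "order_pattern ?L w = order_pattern ?L w'"
      for w w' :: "nat \<times> bool \<Rightarrow> real"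
      using that by (simp only:)
  qed simp
  ultimately have "AE w in distr M (Pi\<^sub>M ?L (\<lambda>_. borel)) (\<lambda>\<omega>. \<lambda>j\<in>?L. W j \<omega>). inj_on w ?L"
    by (subst AE_distr_iff[OF W_PiM_measurable]) auto
  thus ?thesis unfolding distr_W_PiM .
qed

lemma rank_measurable: "{w \<in> space \<Omega>. Q (clock_rank n w)} \<in> sets \<Omega>"
  unfolding sets_\<Omega> space_\<Omega>
proof (rule order_pattern_measurable)
  show "Q (clock_rank n w) = Q (clock_rank n w')"
    if "order_pattern (clock_labels n) w = order_pattern (clock_labels n) w'" for w w'
    using clock_rank_cong_pattern[OF n that] by (simp only:)
qed simp

lemma prob_pos_le_eq_sum:
  assumes x: "0 \<le> x" "x \<le> 1"
  shows "prob {\<omega> \<in> space M. pos n \<omega> \<le> x} =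
    (\<Sum>m\<le>2 * n. measure \<Omega> {w \<in> space \<Omega>. clock_rank n w \<le> m} *
       (real (2 * n choose m) * x ^ m * (1 - x) ^ (2 * n - m)))"
proof -
  let ?L = "clock_labels n"
  interpret P: prob_space \<Omega> by (intro prob_space_PiM prob_space_unif)
  have finite_labels: "finite ?L" by simp
  have card_L: "card ?L = 2 * n" by (simp add: card_cartesian_product UNIV_bool)
  let ?E = "\<lambda>m. {w \<in> space \<Omega>. clock_rank n w \<le> m \<and> count_le ?L x w = m}"
  have E_sets: "?E m \<in> sets \<Omega>" for m
  proof -
    have "?E m = {w \<in> space \<Omega>. clock_rank n w \<le> m} \<inter> {w \<in> space \<Omega>. count_le ?L x w = m}" by auto
    thus ?thesis using rank_measurable[of "\<lambda>r. r \<le> m"] count_le_measurable[of ?L x m] by simp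
  qed
  have union: "{w \<in> space \<Omega>. w (clock_label w n) \<le> x} = (\<Union>m\<in>{..2 * n}. ?E m)"
  proof -
    have "count_le ?L x w \<le> 2 * n" for w
      unfolding card_L[symmetric] by (intro card_mono) auto
    thus ?thesis by (auto simp: clock_rank_le_iff[OF n, symmetric])
  qed
  have factor: "measure \<Omega> (?E m) = measure \<Omega> {w \<in> space \<Omega>. clock_rank n w \<le> m} *
      measure \<Omega> {w \<in> space \<Omega>. count_le ?L x w = m}" for m
  proof (rule pattern_indep_symmetric[where P = "\<lambda>w. clock_rank n w \<le> m"
        and Q = "\<lambda>w. count_le ?L x w = m"])
    show "sets unif = sets borel" by simp
    show "(clock_rank n w \<le> m) = (clock_rank n w' \<le> m)"
      if "order_pattern ?L w = order_pattern ?L w'" for w w'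
      using clock_rank_cong_pattern[OF n that] by simp
    show "(count_le ?L x (\<lambda>i\<in>?L. w (\<pi> i)) = m) = (count_le ?L x w = m)" if "\<pi> permutes ?L" for w \<pi>
      using count_le_permute[OF that] by simp
  qed (fact finite_labels prob_space_unif AE_inj_on count_le_measurable[OF finite_labels])+
  have "prob {\<omega> \<in> space M. pos n \<omega> \<le> x} = measure \<Omega> {w \<in> space \<Omega>. w (clock_label w n) \<le> x}"
  proof (subst prob_transfer)
    show "{w \<in> space \<Omega>. w (clock_label w n) \<le> x} \<in> sets \<Omega>"
      unfolding union using E_sets by auto
    have "pos n \<omega> = (\<lambda>j\<in>?L. W j \<omega>) (clock_label (\<lambda>j\<in>?L. W j \<omega>) n)" if "\<omega> \<in> space M" for \<omega>
    proof -
      have "pos n \<omega> = clock_pos (\<lambda>i. (\<lambda>j\<in>?L. W j \<omega>) (i, False)) (\<lambda>i. (\<lambda>j\<in>?L. W j \<omega>) (i, True)) n"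
        by (rule clock_pos_cong) auto
      also have "\<dots> = (\<lambda>j\<in>?L. W j \<omega>) (clock_label (\<lambda>j\<in>?L. W j \<omega>) n)"
        using W_range[OF _ that] n by (intro clock_pos_eq_label) auto
      finally show ?thesis .
    qed
    thus "prob {\<omega> \<in> space M. pos n \<omega> \<le> x} =
        prob {\<omega> \<in> space M. (\<lambda>j\<in>?L. W j \<omega>) (clock_label (\<lambda>j\<in>?L. W j \<omega>) n) \<le> x}"
      by (intro arg_cong[where f = prob] Collect_cong conj_cong refl) simp
  qed
  also have "\<dots> = (\<Sum>m\<le>2 * n. measure \<Omega> (?E m))"
    unfolding union using E_sets
    by (intro P.finite_measure_finite_Union) (auto simp: disjoint_family_on_def)
  also have "\<dots> = (\<Sum>m\<le>2 * n. measure \<Omega> {w \<in> space \<Omega>. clock_rank n w \<le> m} *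
       (real (2 * n choose m) * x ^ m * (1 - x) ^ (2 * n - m)))"
    by (simp only: factor measure_count_le[OF finite_labels x] card_L)
  finally show ?thesis .
qed

lemma measure_rank_le:
  assumes "m \<le> 2 * n"
  shows "measure \<Omega> {w \<in> space \<Omega>. clock_rank n w \<le> m} = clock_coeff n m"
proof (rule bernstein_unique[OF _ assms])
  fix x :: real assume x: "0 < x" "x < 1"
  show "(\<Sum>m\<le>2 * n. measure \<Omega> {w \<in> space \<Omega>. clock_rank n w \<le> m} *
       (real (2 * n choose m) * x ^ m * (1 - x) ^ (2 * n - m))) =
     (\<Sum>m\<le>2 * n. clock_coeff n m * (real (2 * n choose m) * x ^ m * (1 - x) ^ (2 * n - m)))"
    using prob_pos_le_eq_sum[of x] prob_pos_le[of n x] clock_cdf_bernstein[OF n, of x] n x by simp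
qed

lemma prob_clock_index:
  assumes k: "k \<in> {1..2 * n}"
  shows "prob {\<omega> \<in> space M. clock_index n (\<lambda>i. U i \<omega>) (\<lambda>i. U' i \<omega>) n = k} =
         1 / (2 * real n) - clock_delta n k"
proof -
  let ?L = "clock_labels n"
  interpret P: prob_space \<Omega> by (intro prob_space_PiM prob_space_unif)
  have index: "clock_index n (\<lambda>i. U i \<omega>) (\<lambda>i. U' i \<omega>) n = clock_rank n (\<lambda>j\<in>?L. W j \<omega>)"
    if "\<omega> \<in> space M" for \<omega>
  proof -
    have "clock_index n (\<lambda>i. W (i, False) \<omega>) (\<lambda>i. W (i, True) \<omega>) n = clock_rank n (\<lambda>j. W j \<omega>)"
      using W_range[OF _ that] by (intro clock_index_eq_rank[OF n]) auto
    also have "\<dots> = clock_rank n (\<lambda>j\<in>?L. W j \<omega>)"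
      by (rule clock_rank_cong_pattern[OF n]) (auto simp: order_pattern_def)
    finally show ?thesis by simp
  qed
  have "prob {\<omega> \<in> space M. clock_index n (\<lambda>i. U i \<omega>) (\<lambda>i. U' i \<omega>) n = k} =
      prob {\<omega> \<in> space M. clock_rank n (\<lambda>j\<in>?L. W j \<omega>) = k}"
    using index by (intro arg_cong[where f = prob] Collect_cong conj_cong refl) simp
  also have "\<dots> = measure \<Omega> {w \<in> space \<Omega>. clock_rank n w = k}"
    by (rule prob_transfer[symmetric]) (rule rank_measurable)
  also have "{w \<in> space \<Omega>. clock_rank n w = k} =
      {w \<in> space \<Omega>. clock_rank n w \<le> k} - {w \<in> space \<Omega>. clock_rank n w \<le> k - 1}"
    using k by auto
  also have "measure \<Omega> \<dots> = measure \<Omega> {w \<in> space \<Omega>. clock_rank n w \<le> k} -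
      measure \<Omega> {w \<in> space \<Omega>. clock_rank n w \<le> k - 1}"
    by (rule P.finite_measure_Diff) (use k rank_measurable[of "\<lambda>r. r \<le> k"] rank_measurable[of "\<lambda>r. r \<le> k - 1"] in auto)
  also have "\<dots> = clock_coeff n k - clock_coeff n (k - 1)"
    using k by (subst (1 2) measure_rank_le) auto
  also have "\<dots> = 1 / (2 * real n) - clock_delta n k"
    using n k by (intro clock_coeff_diff) auto
  finally show ?thesis .
qed

end

theorem proposition3p9:
  fixes M :: "'a measure" and U U' :: "nat \<Rightarrow> 'a \<Rightarrow> real" and n k :: nat
  assumes "prob_space M"
    and "n \<ge> 1"
    and "\<And>i \<omega>. i \<in> {1..n} \<Longrightarrow> \<omega> \<in> space M \<Longrightarrow> U i \<omega> \<in> {0..<1} \<and> U' i \<omega> \<in> {0..<1}"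
    and "prob_space.indep_vars M (\<lambda>_. borel) (\<lambda>(i, b). if b then U' i else U i)
           ({1..n} \<times> (UNIV :: bool set))"
    and "\<And>i. i \<in> {1..n} \<Longrightarrow> distr M borel (U i) = uniform_measure lborel {0..<1}"
    and "\<And>i. i \<in> {1..n} \<Longrightarrow> distr M borel (U' i) = uniform_measure lborel {0..<1}"
    and "k \<in> {1..2*n}"
  shows "measure M {\<omega> \<in> space M. clock_index n (\<lambda>i. U i \<omega>) (\<lambda>i. U' i \<omega>) n = k}
           = 1 / (2 * real n) - clock_delta n k"
proof -
  interpret clock_pairs M U U' n
    using assms(1-6) by (intro clock_pairs.intro clock_pairs_axioms.intro) auto
  show ?thesis using assms(7) by (rule prob_clock_index)
qed

end
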